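(* Let $X$ be a d-space with no loops and let $\mathfrak{F}$ be an equivalence system. If $X$ admits a finite stable future (respectively past, total) $\mathfrak{F}$-component system, then there exists a coarsest stable future (respectively past, total) $\mathfrak{F}$-component system on $X$. If $X$ admits a finite closed stable future (respectively past) $\mathfrak{F}$-component system, then the coarsest stable future (respectively past) $\mathfrak{F}$-component system on $X$ is closed.
   Context: **d-spaces.** A d-space is a topological space $X$ with a set $\vec{P}_X$ of continuous paths $[0,1]\to X$ (called d-paths; topologized as a subspace of the path space with the compact-open topology) containing all constant paths $\sigma_x$, closed under concatenation $\alpha*\beta$ (for $\alpha(1)=\beta(0)$) and under precomposition with non-decreasing continuous maps $[0,1]\to[0,1]$. For $A\subseteq X$, $\vec{P}_A$ is the set of d-paths with image in $A$; $\vec{P}_A(B,C)=\{\alpha\in\vec{P}_A : \alpha(0)\in B,\ \alpha(1)\in C\}$ (points are written for singletons). Write $x\le y$ if $\vec{P}_X(x,y)\ne\emptyset$. $X$ has no loops if $\vec{P}_X(x,x)=\{\sigma_x\}$ for all $x$ (then $\le$ is a partial order). $A_{\ge x}=\{y\in A: y\ge x\}$, $A_{\le x}=\{y\in A: y\le x\}$. For d-paths $\alpha,\beta$, $\vec{P}(\alpha,\beta):\vec{P}_X(\alpha(1),\beta(0))\to\vec{P}_X(\alpha(0),\beta(1))$ is the map $\omega\mapsto\alpha*\omega*\beta$. **Equivalence systems.** A family $\mathfrak{F}$ of morphisms of the category of topological spaces is an equivalence system if: (a) it satisfies 2-out-of-3; (b) if $f,g$ are homotopic then both or neither lie in $\mathfrak{F}$;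 (c) it contains all weak homotopy equivalences; (d) $f\in\mathfrak{F}$ implies $\pi_0(f)$ is a bijection; (e) for a finite family of maps $f_i$, $\coprod f_i\in\mathfrak{F}$ iff all $f_i\in\mathfrak{F}$; (f) $f,g\in\mathfrak{F}$ implies $f\times g\in\mathfrak{F}$. Members of $\mathfrak{F}$ are $\mathfrak{F}$-equivalences; two spaces are $\mathfrak{F}$-equivalent if connected by a zig-zag of $\mathfrak{F}$-equivalences; a space $Y$ is $\mathfrak{F}$-contractible if $Y\to\{*\}$ is in $\mathfrak{F}$. **Stability.** $A\subseteq X$ is d-convex if $\vec{P}_A(A,A)=\vec{P}_X(A,A)$; future connected if for all $x,y\in A$ there is $z\in A$ with $\vec{P}_A(x,z)\ne\emptyset\ne\vec{P}_A(y,z)$; past connected if for all $x,y\in A$ there is $z\in A$ with $\vec{P}_A(z,x)\ne\emptyset\ne\vec{P}_A(z,y)$. For $\alpha\in\vec{P}_X$ and $A$ future connected, $\mathrm{St}^+_{\mathfrak{F}}(\alpha;A)$ is the set of $z\in A$ such that $\vec{P}(\alpha,\beta)\in\mathfrak{F}$ for every $\beta\in\vec{P}_{A_{\ge z}}$; for $A$ past connected, $\mathrm{St}^-_{\mathfrak{F}}(A;\alpha)$ is the set of $z\in A$ such that $\vec{P}(\beta,\alpha)\in\mathfrak{F}$ for every $\beta\in\vec{P}_{A_{\le z}}$. For a point $x$ these are taken with $\alpha=\sigma_x$. For future connected $A,B$ the pair $(A,B)$ is future $\mathfrak{F}$-stable if $\mathrm{St}^+_{\mathfrak{F}}(\alpha;B)\ne\emptyset$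 for all $\alpha\in\vec{P}_A$; for past connected $A,B$ it is past $\mathfrak{F}$-stable if $\mathrm{St}^-_{\mathfrak{F}}(A;\beta)\ne\emptyset$ for all $\beta\in\vec{P}_B$. It is totally $\mathfrak{F}$-stable if it is future and past $\mathfrak{F}$-stable and there are $a\in A$, $b\in B$ (a stabilizing pair) with $b\in\mathrm{St}^+_{\mathfrak{F}}(a;B)$ and $a\in\mathrm{St}^-_{\mathfrak{F}}(A;b)$. If $(A,B)$ is future $\mathfrak{F}$-stable, $\mathrm{S}\vec{\mathrm{P}}^+_{\mathfrak{F}}(A,B):=\vec{P}_X(a,z)$ for any $a\in A$, $z\in\mathrm{St}^+_{\mathfrak{F}}(a;B)$ (well defined up to $\mathfrak{F}$-equivalence); if past $\mathfrak{F}$-stable, $\mathrm{S}\vec{\mathrm{P}}^-_{\mathfrak{F}}(A,B):=\vec{P}_X(z,b)$ for any $b\in B$, $z\in\mathrm{St}^-_{\mathfrak{F}}(A;b)$. **Component systems.** A future (past) connected $A$ is future (past) $\mathfrak{F}$-trivial if $(A,A)$ is future (past) $\mathfrak{F}$-stable and $\mathrm{S}\vec{\mathrm{P}}^{+}_{\mathfrak{F}}(A,A)$ (resp. $\mathrm{S}\vec{\mathrm{P}}^{-}_{\mathfrak{F}}(A,A)$) is $\mathfrak{F}$-contractible. A family $\{A_i\}_{i\in I}$ of pairwise disjoint subsets covering $X$ is a stable future (past) $\mathfrak{F}$-component system if every $A_i$ is d-convex, future (past) connected and future (past) $\mathfrak{F}$-trivial, and every pair $(A_i,A_j)$ is future (past)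 $\mathfrak{F}$-stable. A future (past) system is closed if every $A_i$ has a final point, i.e. $x\in A_i$ with $y\le x$ for all $y\in A_i$ (resp. an initial point, $x\in A_i$ with $x\le y$ for all $y\in A_i$). A stable total $\mathfrak{F}$-component system is a family that is both a stable future and a stable past $\mathfrak{F}$-component system and such that every pair $(A_i,A_j)$ is totally $\mathfrak{F}$-stable. **Coarsest.** A system $\mathcal{A}$ is coarser than $\mathcal{B}$ if every $B\in\mathcal{B}$ is contained in some $A\in\mathcal{A}$. A coarsest stable future (past, total) $\mathfrak{F}$-component system on $X$ is one that is coarser than any other stable future (past, total) $\mathfrak{F}$-component system on $X$. *)

theory Defs
  imports "HOL-Analysis.Analysis"
begin

section \<open>Path spaces and d-spaces\<close>

text \<open>
  A path is a function on \<open>{0..1}\<close>, hence represented by an extensional function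
  \<open>real \<Rightarrow> 'a\<close>, so that equality of paths is pointwise equality on \<open>{0..1}\<close>.
\<close>

definition paths :: "'a topology \<Rightarrow> (real \<Rightarrow> 'a) set" where
  "paths X = {g \<in> extensional {0..1}. pathin X g}"

text \<open>The compact-open topology; the generating set for \<open>K = {}\<close> is the whole of \<^term>\<open>paths X\<close>.\<close>

definition path_space :: "'a topology \<Rightarrow> (real \<Rightarrow> 'a) topology" where
  "path_space X = topology_generated_by
     {{g \<in> paths X. g ` K \<subseteq> U} | K U. compact K \<and> K \<subseteq> {0..1} \<and> openin X U}"

definition const_path :: "'a \<Rightarrow> real \<Rightarrow> 'a" where
  "const_path x = (\<lambda>t\<in>{0..1}. x)"

definition concat_path :: "(real \<Rightarrow> 'a) \<Rightarrow> (real \<Rightarrow> 'a) \<Rightarrow> real \<Rightarrow> 'a" where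
  "concat_path \<alpha> \<beta> = (\<lambda>t\<in>{0..1}. if t \<le> 1/2 then \<alpha> (2 * t) else \<beta> (2 * t - 1))"

record 'a dspace =
  underlying :: "'a topology"
  dpaths :: "(real \<Rightarrow> 'a) set"

definition d_space :: "'a dspace \<Rightarrow> bool" where
  "d_space X \<longleftrightarrow>
     dpaths X \<subseteq> paths (underlying X) \<and>
     (\<forall>x\<in>topspace (underlying X). const_path x \<in> dpaths X) \<and>
     (\<forall>\<alpha>\<in>dpaths X. \<forall>\<beta>\<in>dpaths X. \<alpha> 1 = \<beta> 0 \<longrightarrow> concat_path \<alpha> \<beta> \<in> dpaths X) \<and>
     (\<forall>\<alpha>\<in>dpaths X. \<forall>\<phi>::real \<Rightarrow> real.
        continuous_on {0..1} \<phi> \<and> mono_on {0..1} \<phi> \<and> \<phi> ` {0..1} \<subseteq> {0..1}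
          \<longrightarrow> restrict (\<alpha> \<circ> \<phi>) {0..1} \<in> dpaths X)"

definition dpaths_in :: "'a dspace \<Rightarrow> 'a set \<Rightarrow> (real \<Rightarrow> 'a) set" where
  "dpaths_in X A = {\<alpha> \<in> dpaths X. \<alpha> ` {0..1} \<subseteq> A}"

definition dpaths_between :: "'a dspace \<Rightarrow> 'a set \<Rightarrow> 'a set \<Rightarrow> 'a set \<Rightarrow> (real \<Rightarrow> 'a) set" where
  "dpaths_between X A B C = {\<alpha> \<in> dpaths_in X A. \<alpha> 0 \<in> B \<and> \<alpha> 1 \<in> C}"

abbreviation dpaths_from_to :: "'a dspace \<Rightarrow> 'a \<Rightarrow> 'a \<Rightarrow> (real \<Rightarrow> 'a) set" where
  "dpaths_from_to X x y \<equiv> dpaths_between X (topspace (underlying X)) {x} {y}"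

definition dpath_space :: "'a dspace \<Rightarrow> 'a \<Rightarrow> 'a \<Rightarrow> (real \<Rightarrow> 'a) topology" where
  "dpath_space X x y = subtopology (path_space (underlying X)) (dpaths_from_to X x y)"

definition d_le :: "'a dspace \<Rightarrow> 'a \<Rightarrow> 'a \<Rightarrow> bool" where
  "d_le X x y \<longleftrightarrow> dpaths_from_to X x y \<noteq> {}"

definition no_loops :: "'a dspace \<Rightarrow> bool" where
  "no_loops X \<longleftrightarrow> (\<forall>x\<in>topspace (underlying X). dpaths_from_to X x x = {const_path x})"

definition up_part :: "'a dspace \<Rightarrow> 'a set \<Rightarrow> 'a \<Rightarrow> 'a set" where
  "up_part X A x = {y \<in> A. d_le X x y}"

definition down_part :: "'a dspace \<Rightarrow> 'a set \<Rightarrow> 'a \<Rightarrow> 'a set" where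
  "down_part X A x = {y \<in> A. d_le X y x}"


section \<open>Weak homotopy equivalences\<close>

text \<open>
  \<open>pi_n (X, x)\<close> is the set of classes of maps \<open>I^n \<rightarrow> X\<close> sending the boundary to \<open>x\<close>, up to
  homotopy relative to the boundary. The cube \<open>I^n\<close> lives on \<open>nat \<Rightarrow> real\<close> with coordinates \<open>{..<n}\<close>.
\<close>

definition cube_top :: "nat \<Rightarrow> (nat \<Rightarrow> real) topology" where
  "cube_top n = product_topology (\<lambda>_. top_of_set {0..1}) {..<n}"

definition cube_boundary :: "nat \<Rightarrow> (nat \<Rightarrow> real) set" where
  "cube_boundary n = {t \<in> topspace (cube_top n). \<exists>i<n. t i = 0 \<or> t i = 1}"

definition cube_maps :: "nat \<Rightarrow> 'a topology \<Rightarrow> 'a \<Rightarrow> ((nat \<Rightarrow> real) \<Rightarrow> 'a) set" where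
  "cube_maps n X x = {g. continuous_map (cube_top n) X g \<and> (\<forall>t\<in>cube_boundary n. g t = x)}"

definition cube_homotopic ::
  "nat \<Rightarrow> 'a topology \<Rightarrow> 'a \<Rightarrow> (((nat \<Rightarrow> real) \<Rightarrow> 'a) \<times> ((nat \<Rightarrow> real) \<Rightarrow> 'a)) set" where
  "cube_homotopic n X x =
     {(g, h). homotopic_with (\<lambda>k. \<forall>t\<in>cube_boundary n. k t = x) (cube_top n) X g h}"

definition homotopy_group_set :: "nat \<Rightarrow> 'a topology \<Rightarrow> 'a \<Rightarrow> ((nat \<Rightarrow> real) \<Rightarrow> 'a) set set" where
  "homotopy_group_set n X x = cube_maps n X x // cube_homotopic n X x"

definition homotopy_group_map ::
  "nat \<Rightarrow> 'b topology \<Rightarrow> ('a \<Rightarrow> 'b) \<Rightarrow> 'a \<Rightarrow> ((nat \<Rightarrow> real) \<Rightarrow> 'a) set \<Rightarrow> ((nat \<Rightarrow> real) \<Rightarrow> 'b) set" where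
  "homotopy_group_map n Y f x C = cube_homotopic n Y (f x) `` ((\<lambda>g. f \<circ> g) ` C)"

text \<open>\<open>pi_0\<close> is the set of path components, sent to the path components containing their images.\<close>

definition pi0_map :: "'b topology \<Rightarrow> ('a \<Rightarrow> 'b) \<Rightarrow> 'a set \<Rightarrow> 'b set" where
  "pi0_map Y f C = (\<Union>x\<in>C. path_component_of_set Y (f x))"

definition pi0_bijective :: "'a topology \<Rightarrow> 'b topology \<Rightarrow> ('a \<Rightarrow> 'b) \<Rightarrow> bool" where
  "pi0_bijective X Y f \<longleftrightarrow>
     bij_betw (pi0_map Y f) (path_components_of X) (path_components_of Y)"

text \<open>
  The maps induced on \<open>pi_n\<close>, \<open>n \<ge> 1\<close>, are group homomorphisms, so they are isomorphisms
  exactly if they are bijective.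
\<close>

definition weak_homotopy_equivalence :: "'a topology \<Rightarrow> 'b topology \<Rightarrow> ('a \<Rightarrow> 'b) \<Rightarrow> bool" where
  "weak_homotopy_equivalence X Y f \<longleftrightarrow>
     continuous_map X Y f \<and>
     pi0_bijective X Y f \<and>
     (\<forall>n\<ge>1. \<forall>x\<in>topspace X.
        bij_betw (homotopy_group_map n Y f x)
          (homotopy_group_set n X x) (homotopy_group_set n Y (f x)))"


section \<open>Equivalence systems\<close>

text \<open>
  The type \<open>'u\<close> plays the role of a universe of points: \<open>F S T f\<close> says that the morphism
  \<open>f: S \<rightarrow> T\<close> between spaces with points in \<open>'u\<close> belongs to the family. A morphism is a function
  restricted to the carrier of its source; \<open>F\<close> respects this by closure under homotopy below.
\<close>

type_synonym 'u morphism_family = "'u topology \<Rightarrow> 'u topology \<Rightarrow> ('u \<Rightarrow> 'u) \<Rightarrow> bool"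

text \<open>
  Membership in \<open>F\<close> of a map between spaces over other types: some homeomorphic copy
  inside \<open>'u\<close> lies in \<open>F\<close>. By 2-out-of-3, and since homeomorphisms are weak homotopy
  equivalences, the choice of the copy is irrelevant for an equivalence system.
\<close>

definition F_equivalence ::
  "'u morphism_family \<Rightarrow> 'a topology \<Rightarrow> 'b topology \<Rightarrow> ('a \<Rightarrow> 'b) \<Rightarrow> bool" where
  "F_equivalence F S T f \<longleftrightarrow>
     (\<exists>S' T' h h' k k'. homeomorphic_maps S S' h h' \<and> homeomorphic_maps T T' k k' \<and>
        F S' T' (k \<circ> f \<circ> h'))"

text \<open>
  For infinite \<open>'u\<close>, finite products and coproducts of spaces in \<open>'u\<close> have copies in \<open>'u\<close>.
  Conversely the axioms on products and coproducts force \<open>'u\<close> to be infinite.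
\<close>

definition equivalence_system :: "'u morphism_family \<Rightarrow> bool" where
  "equivalence_system F \<longleftrightarrow>
     (\<forall>S T f. F S T f \<longrightarrow> continuous_map S T f) \<and>
     (\<forall>S T U f g. continuous_map S T f \<and> continuous_map T U g \<longrightarrow>
        (F S T f \<and> F T U g \<longrightarrow> F S U (g \<circ> f)) \<and>
        (F S T f \<and> F S U (g \<circ> f) \<longrightarrow> F T U g) \<and>
        (F T U g \<and> F S U (g \<circ> f) \<longrightarrow> F S T f)) \<and>
     (\<forall>S T f g. homotopic_with (\<lambda>_. True) S T f g \<longrightarrow> (F S T f \<longleftrightarrow> F S T g)) \<and>
     (\<forall>S T f. weak_homotopy_equivalence S T f \<longrightarrow> F S T f) \<and>
     (\<forall>S T f. F S T f \<longrightarrow> pi0_bijective S T f) \<and>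
     (\<forall>(n::nat) S T f. (\<forall>i<n. continuous_map (S i) (T i) (f i)) \<longrightarrow>
        (F_equivalence F (sum_topology S {..<n}) (sum_topology T {..<n}) (\<lambda>(i, x). (i, f i x))
           \<longleftrightarrow> (\<forall>i<n. F (S i) (T i) (f i)))) \<and>
     (\<forall>S T f S' T' g. F S T f \<and> F S' T' g \<longrightarrow>
        F_equivalence F (prod_topology S S') (prod_topology T T') (map_prod f g))"

definition F_contractible :: "'u morphism_family \<Rightarrow> 'a topology \<Rightarrow> bool" where
  "F_contractible F Y \<longleftrightarrow> F_equivalence F Y (discrete_topology {()}) (\<lambda>_. ())"


section \<open>Stability\<close>

definition d_convex :: "'a dspace \<Rightarrow> 'a set \<Rightarrow> bool" where
  "d_convex X A \<longleftrightarrow> dpaths_between X A A A = dpaths_between X (topspace (underlying X)) A A"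

definition future_connected :: "'a dspace \<Rightarrow> 'a set \<Rightarrow> bool" where
  "future_connected X A \<longleftrightarrow>
     (\<forall>x\<in>A. \<forall>y\<in>A. \<exists>z\<in>A. dpaths_between X A {x} {z} \<noteq> {} \<and> dpaths_between X A {y} {z} \<noteq> {})"

definition past_connected :: "'a dspace \<Rightarrow> 'a set \<Rightarrow> bool" where
  "past_connected X A \<longleftrightarrow>
     (\<forall>x\<in>A. \<forall>y\<in>A. \<exists>z\<in>A. dpaths_between X A {z} {x} \<noteq> {} \<and> dpaths_between X A {z} {y} \<noteq> {})"

text \<open>The map \<open>\<omega> \<mapsto> \<alpha> * \<omega> * \<beta>\<close> on d-paths from \<open>\<alpha> 1\<close> to \<open>\<beta> 0\<close> is an \<open>F\<close>-equivalence.\<close>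

definition extension_in ::
  "'u morphism_family \<Rightarrow> 'a dspace \<Rightarrow> (real \<Rightarrow> 'a) \<Rightarrow> (real \<Rightarrow> 'a) \<Rightarrow> bool" where
  "extension_in F X \<alpha> \<beta> \<longleftrightarrow>
     F_equivalence F (dpath_space X (\<alpha> 1) (\<beta> 0)) (dpath_space X (\<alpha> 0) (\<beta> 1))
       (\<lambda>\<omega>. concat_path (concat_path \<alpha> \<omega>) \<beta>)"

definition St_future ::
  "'u morphism_family \<Rightarrow> 'a dspace \<Rightarrow> (real \<Rightarrow> 'a) \<Rightarrow> 'a set \<Rightarrow> 'a set" where
  "St_future F X \<alpha> A = {z \<in> A. \<forall>\<beta>\<in>dpaths_in X (up_part X A z). extension_in F X \<alpha> \<beta>}"

definition St_past ::
  "'u morphism_family \<Rightarrow> 'a dspace \<Rightarrow> 'a set \<Rightarrow> (real \<Rightarrow> 'a) \<Rightarrow> 'a set" where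
  "St_past F X A \<alpha> = {z \<in> A. \<forall>\<beta>\<in>dpaths_in X (down_part X A z). extension_in F X \<beta> \<alpha>}"

definition future_stable :: "'u morphism_family \<Rightarrow> 'a dspace \<Rightarrow> 'a set \<Rightarrow> 'a set \<Rightarrow> bool" where
  "future_stable F X A B \<longleftrightarrow>
     future_connected X A \<and> future_connected X B \<and>
     (\<forall>\<alpha>\<in>dpaths_in X A. St_future F X \<alpha> B \<noteq> {})"

definition past_stable :: "'u morphism_family \<Rightarrow> 'a dspace \<Rightarrow> 'a set \<Rightarrow> 'a set \<Rightarrow> bool" where
  "past_stable F X A B \<longleftrightarrow>
     past_connected X A \<and> past_connected X B \<and>
     (\<forall>\<beta>\<in>dpaths_in X B. St_past F X A \<beta> \<noteq> {})"

definition totally_stable :: "'u morphism_family \<Rightarrow> 'a dspace \<Rightarrow> 'a set \<Rightarrow> 'a set \<Rightarrow> bool" where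
  "totally_stable F X A B \<longleftrightarrow>
     future_stable F X A B \<and> past_stable F X A B \<and>
     (\<exists>a\<in>A. \<exists>b\<in>B. b \<in> St_future F X (const_path a) B \<and> a \<in> St_past F X A (const_path b))"

text \<open>
  The stable path spaces are only well defined up to \<open>F\<close>-equivalence; we take the set of
  all representatives.
\<close>

definition SP_future ::
  "'u morphism_family \<Rightarrow> 'a dspace \<Rightarrow> 'a set \<Rightarrow> 'a set \<Rightarrow> (real \<Rightarrow> 'a) topology set" where
  "SP_future F X A B = {dpath_space X a z | a z. a \<in> A \<and> z \<in> St_future F X (const_path a) B}"

definition SP_past ::
  "'u morphism_family \<Rightarrow> 'a dspace \<Rightarrow> 'a set \<Rightarrow> 'a set \<Rightarrow> (real \<Rightarrow> 'a) topology set" where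
  "SP_past F X A B = {dpath_space X z b | z b. b \<in> B \<and> z \<in> St_past F X A (const_path b)}"


section \<open>Component systems\<close>

text \<open>
  Since the stable path space is unique up to \<open>F\<close>-equivalence, it is immaterial which
  representative is \<open>F\<close>-contractible. The existence of a representative makes \<open>A\<close> nonempty.
\<close>

definition future_trivial :: "'u morphism_family \<Rightarrow> 'a dspace \<Rightarrow> 'a set \<Rightarrow> bool" where
  "future_trivial F X A \<longleftrightarrow>
     future_stable F X A A \<and> (\<exists>Y\<in>SP_future F X A A. F_contractible F Y)"

definition past_trivial :: "'u morphism_family \<Rightarrow> 'a dspace \<Rightarrow> 'a set \<Rightarrow> bool" where
  "past_trivial F X A \<longleftrightarrow>
     past_stable F X A A \<and> (\<exists>Y\<in>SP_past F X A A. F_contractible F Y)"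

definition disjoint_cover :: "'a dspace \<Rightarrow> 'a set set \<Rightarrow> bool" where
  "disjoint_cover X \<A> \<longleftrightarrow> pairwise disjnt \<A> \<and> \<Union>\<A> = topspace (underlying X)"

definition stable_future_system :: "'u morphism_family \<Rightarrow> 'a dspace \<Rightarrow> 'a set set \<Rightarrow> bool" where
  "stable_future_system F X \<A> \<longleftrightarrow>
     disjoint_cover X \<A> \<and>
     (\<forall>A\<in>\<A>. d_convex X A \<and> future_connected X A \<and> future_trivial F X A) \<and>
     (\<forall>A\<in>\<A>. \<forall>B\<in>\<A>. future_stable F X A B)"

definition stable_past_system :: "'u morphism_family \<Rightarrow> 'a dspace \<Rightarrow> 'a set set \<Rightarrow> bool" where
  "stable_past_system F X \<A> \<longleftrightarrow>
     disjoint_cover X \<A> \<and>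
     (\<forall>A\<in>\<A>. d_convex X A \<and> past_connected X A \<and> past_trivial F X A) \<and>
     (\<forall>A\<in>\<A>. \<forall>B\<in>\<A>. past_stable F X A B)"

definition stable_total_system :: "'u morphism_family \<Rightarrow> 'a dspace \<Rightarrow> 'a set set \<Rightarrow> bool" where
  "stable_total_system F X \<A> \<longleftrightarrow>
     stable_future_system F X \<A> \<and> stable_past_system F X \<A> \<and>
     (\<forall>A\<in>\<A>. \<forall>B\<in>\<A>. totally_stable F X A B)"

definition future_closed :: "'a dspace \<Rightarrow> 'a set set \<Rightarrow> bool" where
  "future_closed X \<A> \<longleftrightarrow> (\<forall>A\<in>\<A>. \<exists>x\<in>A. \<forall>y\<in>A. d_le X y x)"

definition past_closed :: "'a dspace \<Rightarrow> 'a set set \<Rightarrow> bool" where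
  "past_closed X \<A> \<longleftrightarrow> (\<forall>A\<in>\<A>. \<exists>x\<in>A. \<forall>y\<in>A. d_le X x y)"

definition coarser :: "'a set set \<Rightarrow> 'a set set \<Rightarrow> bool" where
  "coarser \<A> \<B> \<longleftrightarrow> (\<forall>B\<in>\<B>. \<exists>A\<in>\<A>. B \<subseteq> A)"

definition coarsest :: "('a set set \<Rightarrow> bool) \<Rightarrow> 'a set set \<Rightarrow> bool" where
  "coarsest is_system \<A> \<longleftrightarrow> is_system \<A> \<and> (\<forall>\<B>. is_system \<B> \<longrightarrow> coarser \<A> \<B>)"

end

theory Submission
  imports Defs
begin

text \<open>
Call two points related if they lie in a common member of one of two systems \<open>\<A>\<close> and \<open>\<B>\<close>.
  The classes of the generated equivalence relation form the finest partition \<open>join \<A> \<B>\<close> that is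
  coarser than both. The heart of the matter is \<open>system_join\<close>: if \<open>\<A>\<close> is finite, then \<open>join \<A> \<B>\<close>
  is again a component system. Given this, a finite system \<open>\<A>\<close> with the least possible number of
  members is coarsest: passing to \<open>join \<A> \<B>\<close> cannot lower that number, hence \<open>join \<A> \<B> = \<A>\<close>
  (\<open>coarsest_exists\<close>). A member of the coarsest system is directed and is a finite union of
  members of any finite closed system, so an upper bound of their final points is a final point of
  it (\<open>closed_coarser\<close>).

  Stability splits into two halves. The map \<open>\<omega> \<mapsto> \<alpha> * \<omega> * \<beta>\<close> is, up to homotopy, the composite in
  either order of the extension by \<open>\<alpha>\<close> on the left and by \<open>\<beta>\<close> on the right. By 2-out-of-3,
  \<open>St\<^sup>+(\<alpha>; Z)\<close> is nonempty iff left extension by \<open>\<alpha>\<close> is an equivalence for all targets far out in \<open>Z\<close>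
  (\<open>Lst \<alpha> Z\<close>) and right extension of paths issuing from the source of \<open>\<alpha>\<close> is one for all \<open>\<beta>\<close> far out
  in \<open>Z\<close> (\<open>Rst\<close>). The second half depends on a single point only; it holds for every point of \<open>X\<close> and
  every member \<open>Z\<close> of a system, as the system covers \<open>X\<close>. The first half satisfies 2-out-of-3 under
  concatenation of \<open>\<alpha>\<close>'s.

  Each class \<open>C\<close> contains finitely many members of \<open>\<A>\<close>. A maximal one \<open>Z\<close> is an end of \<open>C\<close>: every
  \<open>B \<in> \<B>\<close> that meets \<open>Z\<close> lies in \<open>Z\<close> from some point on. This transfers stability from \<open>\<B>\<close> to \<open>Z\<close>
  (\<open>Lst_terminal_other\<close>): for a path \<open>\<delta>\<close> inside a member of \<open>\<B>\<close>, a target in \<open>Z\<close> can be pushed within \<open>Z\<close>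
  to a place where the stability given by \<open>\<B>\<close> applies, and right extensions bring the result back.
  So paths inside members of \<open>\<A>\<close> and of \<open>\<B>\<close> are all left stable with respect to ends, and three
  properties become constant on \<open>C\<close>: reaching a given end, having a contractible space of paths to
  far points of \<open>Z\<close>, and left stability of all paths into \<open>Z\<close> with respect to a given end
  (\<open>Lst_to_terminal\<close>). Paths of \<open>C\<close> cannot be cut into pieces inside the members, since preimages of
  members under a path need not be closed. Instead, between two points with a contractible path
  space all paths are homotopic, so stability of one well-chosen path gives it for all of them.

  The past case is the same argument for reversed paths. It is covered by stating the argument for
  abstract paths with a source, a target, and left and right extensions (locale \<open>stable_paths\<close>) and
  exchanging the two sides. Since \<open>join \<A> \<B>\<close> does not refer to a direction, it is a future and a past
  system at once if \<open>\<A>\<close> and \<open>\<B>\<close> are total, and a stabilizing pair for the past end of one class and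
  the future end of another one is stabilizing for the two classes.
\<close>

section \<open>The compact-open topology on paths\<close>

lemma topspace_path_space [simp]: "topspace (path_space X) = paths X"
proof -
  have "paths X \<in> {{g \<in> paths X. g ` K \<subseteq> U} | K U. compact K \<and> K \<subseteq> {0..1} \<and> openin X U}"
    by (rule CollectI, rule exI[of _ "{}"], rule exI[of _ "topspace X"]) auto
  then show ?thesis unfolding path_space_def topology_generated_by_topspace by blast
qed

text \<open>
  One half of the exponential law: a family of paths that is jointly continuous in parameter and
  time is continuous for the compact-open topology. This is the tube lemma for compact sets of
  times. Together with the continuity of evaluation it reduces all continuity
  questions about path spaces to maps into the underlying space.
\<close>

lemma continuous_map_into_path_space:
  assumes h: "continuous_map (prod_topology W (top_of_set {0..1})) X h"
  shows "continuous_map W (path_space X) (\<lambda>w. \<lambda>t\<in>{0..1}. h (w, t))" (is "continuous_map _ _ ?\<phi>")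
proof -
  have path: "?\<phi> w \<in> paths X" if "w \<in> topspace W" for w
  proof -
    have "continuous_map (top_of_set {0..1}) X (h \<circ> Pair w)"
      using continuous_map_o_Pair[OF h that] .
    then have "continuous_map (top_of_set {0..1}) X (\<lambda>t\<in>{0..1}. h (w, t))"
      by (rule continuous_map_eq) auto
    then show ?thesis by (auto simp: paths_def pathin_def)
  qed
  show ?thesis
    unfolding path_space_def
  proof (rule continuous_on_generated_topo)
    fix \<U> assume "\<U> \<in> {{g \<in> paths X. g ` K \<subseteq> U} | K U. compact K \<and> K \<subseteq> {0..1} \<and> openin X U}"
    then obtain K U where KU: "compact K" "K \<subseteq> {0..1}" "openin X U"
      and \<U>: "\<U> = {g \<in> paths X. g ` K \<subseteq> U}" by blast
    let ?N = "{p \<in> topspace (prod_topology W (top_of_set {0..1})). h p \<in> U}"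
    have N: "openin (prod_topology W (top_of_set {0..1})) ?N"
      using openin_continuous_map_preimage[OF h KU(3)] .
    have cK: "compactin (top_of_set {0..1::real}) K"
      using KU by (simp add: compactin_subtopology)
    show "openin W (?\<phi> -` \<U> \<inter> topspace W)"
    proof (subst openin_subopen, intro ballI)
      fix w assume w: "w \<in> ?\<phi> -` \<U> \<inter> topspace W"
      then have "h (w, t) \<in> U" if "t \<in> K" for t
        using that KU(2) by (force simp: \<U> restrict_def)
      then have "{w} \<times> K \<subseteq> ?N" using KU(2) w by auto
      then obtain A V where AV: "openin W A" "w \<in> A" "K \<subseteq> V" "A \<times> V \<subseteq> ?N"
        using tube_lemma_right[OF N cK, of w] w by blast
      have "A \<subseteq> ?\<phi> -` \<U> \<inter> topspace W"
      proof
        fix a assume a: "a \<in> A"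
        then have "a \<in> topspace W" using AV(1) openin_subset by blast
        then show "a \<in> ?\<phi> -` \<U> \<inter> topspace W" using path[of a] a AV KU(2) by (auto simp: \<U>)
      qed
      then show "\<exists>T. openin W T \<and> w \<in> T \<and> T \<subseteq> ?\<phi> -` \<U> \<inter> topspace W" using AV by blast
    qed
  next
    have "\<Union> {{g \<in> paths X. g ` K \<subseteq> U} | K U. compact K \<and> K \<subseteq> {0..1} \<and> openin X U} = paths X"
      using topspace_path_space[of X] unfolding path_space_def topology_generated_by_topspace .
    then show "?\<phi> ` topspace W
        \<subseteq> \<Union> {{g \<in> paths X. g ` K \<subseteq> U} | K U. compact K \<and> K \<subseteq> {0..1} \<and> openin X U}"
      using path by blast
  qed
qed

text \<open>
  The other half of the exponential law; it rests on the local compactness of the unit interval.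
\<close>

lemma continuous_map_evaluation:
  "continuous_map (prod_topology (path_space X) (top_of_set {0..1})) X (\<lambda>(g, t). g t)"
  unfolding continuous_map_def
proof (intro conjI allI impI)
  show "(\<lambda>(g, t). g t) \<in> topspace (prod_topology (path_space X) (top_of_set {0..1})) \<rightarrow> topspace X"
    by (fastforce simp: paths_def pathin_def continuous_map_def)
  fix U assume U: "openin X U"
  let ?P = "{p \<in> topspace (prod_topology (path_space X) (top_of_set {0..1})). (case p of (g, t) \<Rightarrow> g t) \<in> U}"
  show "openin (prod_topology (path_space X) (top_of_set {0..1})) ?P"
    unfolding openin_prod_topology_alt
  proof (intro allI impI)
    fix g and t :: real assume "(g, t) \<in> ?P"
    then have g: "g \<in> paths X" and t: "t \<in> {0..1}" and gt: "g t \<in> U" by auto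
    have "openin (top_of_set {0..1}) {s \<in> {0..1}. g s \<in> U}"
      using g openin_continuous_map_preimage[OF _ U, of "top_of_set {0..1}" g]
      by (simp add: paths_def pathin_def)
    then obtain e where e: "e > 0" "\<And>s. s \<in> {0..1} \<Longrightarrow> dist s t < e \<Longrightarrow> g s \<in> U"
      using t gt unfolding openin_euclidean_subtopology_iff by blast
    define K where "K = cball t (e/2) \<inter> {0..1}"
    have K: "compact K" "K \<subseteq> {0..1}" by (auto simp: K_def)
    have "g ` K \<subseteq> U" using e by (auto simp: K_def dist_commute)
    have 1: "openin (path_space X) {f \<in> paths X. f ` K \<subseteq> U}"
      unfolding path_space_def by (rule topology_generated_by_Basis) (use K U in blast)
    have 2: "openin (top_of_set {0..1}) ({0..1} \<inter> ball t (e/2))" by (simp add: openin_open_Int)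
    have 3: "{f \<in> paths X. f ` K \<subseteq> U} \<times> ({0..1} \<inter> ball t (e/2)) \<subseteq> ?P"
      by (auto simp: K_def image_subset_iff)
    show "\<exists>A B. openin (path_space X) A \<and> openin (top_of_set {0..1}) B \<and> g \<in> A \<and> t \<in> B \<and> A \<times> B \<subseteq> ?P"
      by (rule exI[of _ "{f \<in> paths X. f ` K \<subseteq> U}"], rule exI[of _ "{0..1} \<inter> ball t (e/2)"])
        (use 1 2 3 g t e \<open>g ` K \<subseteq> U\<close> in auto)
  qed
qed

lemma continuous_map_eval2:
  assumes "continuous_map W (path_space X) p" "continuous_map W (top_of_set {0..1}) \<tau>"
  shows "continuous_map W X (\<lambda>w. p w (\<tau> w))"
proof -
  have "continuous_map W (prod_topology (path_space X) (top_of_set {0..1})) (\<lambda>w. (p w, \<tau> w))"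
    using assms by (simp add: continuous_map_pairwise o_def)
  from continuous_map_compose[OF this continuous_map_evaluation] show ?thesis by (simp add: o_def)
qed

lemma continuous_map_concat_path:
  assumes p: "continuous_map W (path_space X) p" and q: "continuous_map W (path_space X) q"
    and pq: "\<And>w. w \<in> topspace W \<Longrightarrow> p w 1 = q w 0"
  shows "continuous_map W (path_space X) (\<lambda>w. concat_path (p w) (q w))"
proof -
  let ?I = "top_of_set {0..1::real}"
  let ?W = "prod_topology W ?I"
  have snd: "continuous_map ?W euclideanreal snd"
    using continuous_map_snd continuous_map_into_fulltopology by blast
  have 1: "continuous_map (subtopology ?W {x \<in> topspace ?W. snd x \<le> 1/2}) X (\<lambda>x. p (fst x) (2 * snd x))"
  proof (rule continuous_map_eval2)
    show "continuous_map (subtopology ?W {x \<in> topspace ?W. snd x \<le> 1/2}) (path_space X) (\<lambda>x. p (fst x))"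
      using continuous_map_compose[OF continuous_map_fst p]
      by (intro continuous_map_from_subtopology) (simp add: o_def)
    show "continuous_map (subtopology ?W {x \<in> topspace ?W. snd x \<le> 1/2}) ?I (\<lambda>x. 2 * snd x)"
      using snd by (auto simp: continuous_map_in_subtopology intro!: continuous_intros continuous_map_from_subtopology)
  qed
  have 2: "continuous_map (subtopology ?W {x \<in> topspace ?W. 1/2 \<le> snd x}) X (\<lambda>x. q (fst x) (2 * snd x - 1))"
  proof (rule continuous_map_eval2)
    show "continuous_map (subtopology ?W {x \<in> topspace ?W. 1/2 \<le> snd x}) (path_space X) (\<lambda>x. q (fst x))"
      using continuous_map_compose[OF continuous_map_fst q]
      by (intro continuous_map_from_subtopology) (simp add: o_def)
    show "continuous_map (subtopology ?W {x \<in> topspace ?W. 1/2 \<le> snd x}) ?I (\<lambda>x. 2 * snd x - 1)"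
      using snd by (auto simp: continuous_map_in_subtopology intro!: continuous_intros continuous_map_from_subtopology)
  qed
  have "continuous_map ?W X (\<lambda>x. if snd x \<le> 1/2 then p (fst x) (2 * snd x) else q (fst x) (2 * snd x - 1))"
  proof (rule continuous_map_cases_le[OF snd _ 1 2])
    fix x assume x: "x \<in> topspace ?W" "snd x = 1/2"
    then have "fst x \<in> topspace W" by auto
    then show "p (fst x) (2 * snd x) = q (fst x) (2 * snd x - 1)" 
      using pq[of "fst x"] unfolding x(2) by simp
  qed simp
  from continuous_map_into_path_space[OF this] show ?thesis
    unfolding concat_path_def by (rule continuous_map_eq) auto
qed

lemma continuous_map_reparam:
  assumes p: "continuous_map W (path_space X) p"
    and \<tau>: "continuous_map (prod_topology W (top_of_set {0..1})) (top_of_set {0..1}) (\<lambda>(w, t). \<tau> w t)"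
  shows "continuous_map W (path_space X) (\<lambda>w. \<lambda>t\<in>{0..1}. p w (\<tau> w t))"
proof -
  have "continuous_map (prod_topology W (top_of_set {0..1})) X (\<lambda>x. p (fst x) (\<tau> (fst x) (snd x)))"
  proof (rule continuous_map_eval2)
    show "continuous_map (prod_topology W (top_of_set {0..1})) (path_space X) (\<lambda>x. p (fst x))"
      using continuous_map_compose[OF continuous_map_fst p] by (simp add: o_def)
    show "continuous_map (prod_topology W (top_of_set {0..1})) (top_of_set {0..1}) (\<lambda>x. \<tau> (fst x) (snd x))"
      using \<tau> by (simp add: case_prod_unfold)
  qed
  from continuous_map_into_path_space[OF this] show ?thesis by simp
qed

section \<open>Homeomorphisms are weak homotopy equivalences\<close>

lemma homeomorphic_maps_pi0_bijective:
  assumes "homeomorphic_maps X Y f g"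
  shows "pi0_bijective X Y f"
proof -
  have hf: "homeomorphic_map X Y f" using assms homeomorphic_maps_map by blast
  have inj: "inj_on f (topspace X)" using hf homeomorphic_imp_injective_map by blast
  have eq: "pi0_map Y f C = f ` C" if C: "C \<in> path_components_of X" for C
  proof -
    obtain x where x: "x \<in> topspace X" "C = path_component_of_set X x"
      using C by (auto simp: path_components_of_def)
    have *: "path_component_of_set Y (f y) = f ` C" if "y \<in> C" for y
    proof -
      have "y \<in> topspace X" using that x path_component_of_subset_topspace by fastforce
      moreover have "path_component_of_set X y = C"
        using that x path_component_of_equiv[of X x y] by auto
      ultimately show ?thesis using homeomorphic_map_path_component_of[OF hf] by metis
    qed
    moreover have "x \<in> C" using x path_component_of_refl by fastforce
    ultimately show ?thesis unfolding pi0_map_def by blast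
  qed
  have "inj_on (image f) (path_components_of X)"
    by (rule inj_on_subset[OF inj_on_image_Pow[OF inj]]) (use path_components_of_subset in blast)
  then have "bij_betw (image f) (path_components_of X) (path_components_of Y)"
    unfolding bij_betw_def using homeomorphic_map_path_components_of[OF hf] by blast
  moreover have "bij_betw (pi0_map Y f) (path_components_of X) (path_components_of Y)
      \<longleftrightarrow> bij_betw (image f) (path_components_of X) (path_components_of Y)"
    by (rule bij_betw_cong) (rule eq)
  ultimately show ?thesis unfolding pi0_bijective_def by simp
qed

lemma cube_boundary_subset: "cube_boundary n \<subseteq> topspace (cube_top n)"
  by (auto simp: cube_boundary_def)

lemma cube_homotopic_compose:
  assumes f: "continuous_map X Y f" and "(g, h) \<in> cube_homotopic n X x"
  shows "(f \<circ> g, f \<circ> h) \<in> cube_homotopic n Y (f x)"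
  using assms(2) unfolding cube_homotopic_def
  by (auto intro: homotopic_with_compose_continuous_map_left[OF _ f])

lemma cube_homotopic_sym: "(g, h) \<in> cube_homotopic n X x \<Longrightarrow> (h, g) \<in> cube_homotopic n X x"
  by (auto simp: cube_homotopic_def intro: homotopic_with_symD)

lemma cube_homotopic_trans:
  "(g, h) \<in> cube_homotopic n X x \<Longrightarrow> (h, k) \<in> cube_homotopic n X x \<Longrightarrow> (g, k) \<in> cube_homotopic n X x"
  by (auto simp: cube_homotopic_def intro: homotopic_with_trans)

lemma cube_homotopic_class_eq:
  assumes "(g, h) \<in> cube_homotopic n X x"
  shows "cube_homotopic n X x `` {g} = cube_homotopic n X x `` {h}"
  using assms cube_homotopic_sym cube_homotopic_trans by fast

lemma cube_homotopic_equal: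
  assumes "g \<in> cube_maps n X x" "\<And>u. u \<in> topspace (cube_top n) \<Longrightarrow> g u = h u"
  shows "(g, h) \<in> cube_homotopic n X x"
proof -
  have "h t = x" if "t \<in> cube_boundary n" for t
    using assms(1) assms(2)[of t] that cube_boundary_subset[of n] by (auto simp: cube_maps_def)
  then show ?thesis
    using assms unfolding cube_maps_def cube_homotopic_def by (auto intro!: homotopic_with_equal)
qed

lemma homotopy_group_map_class:
  assumes f: "continuous_map X Y f" and g: "g \<in> cube_maps n X x"
  shows "homotopy_group_map n Y f x (cube_homotopic n X x `` {g}) = cube_homotopic n Y (f x) `` {f \<circ> g}"
proof -
  let ?Hx = "cube_homotopic n X x" and ?Hy = "cube_homotopic n Y (f x)"
  have 1: "?Hy `` {f \<circ> h} = ?Hy `` {f \<circ> g}" if "(g, h) \<in> ?Hx" for h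
    using cube_homotopic_class_eq[OF cube_homotopic_compose[OF f that]] by simp
  have "(g, g) \<in> ?Hx" by (rule cube_homotopic_equal[OF g]) simp
  then have "(\<Union>h\<in>?Hx `` {g}. ?Hy `` {f \<circ> h}) = ?Hy `` {f \<circ> g}"
    using 1 by blast
  moreover have "homotopy_group_map n Y f x C = (\<Union>h\<in>C. ?Hy `` {f \<circ> h})" for C
    unfolding homotopy_group_map_def by blast
  ultimately show ?thesis by simp
qed

lemma cube_maps_compose:
  "continuous_map X Y f \<Longrightarrow> g \<in> cube_maps n X x \<Longrightarrow> f \<circ> g \<in> cube_maps n Y (f x)"
  by (auto simp: cube_maps_def intro: continuous_map_compose)

text \<open>
  Functoriality of homotopy groups, in the form that is needed for a pair of inverse maps.
\<close>

lemma homotopy_group_map_left_inverse: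
  assumes f: "continuous_map X Y f" and g: "continuous_map Y X g"
    and gf: "\<And>x. x \<in> topspace X \<Longrightarrow> g (f x) = x" and x: "x \<in> topspace X"
    and C: "C \<in> homotopy_group_set n X x"
  shows "homotopy_group_map n Y f x C \<in> homotopy_group_set n Y (f x)"
    and "homotopy_group_map n X g (f x) (homotopy_group_map n Y f x C) = C"
proof -
  obtain u where u: "u \<in> cube_maps n X x" "C = cube_homotopic n X x `` {u}"
    using C by (auto simp: homotopy_group_set_def quotient_def)
  have fu: "f \<circ> u \<in> cube_maps n Y (f x)" using cube_maps_compose[OF f u(1)] .
  then show "homotopy_group_map n Y f x C \<in> homotopy_group_set n Y (f x)"
    unfolding u(2) homotopy_group_map_class[OF f u(1)] homotopy_group_set_def by (rule quotientI)
  have "u t \<in> topspace X" if "t \<in> topspace (cube_top n)" for t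
    using u(1) that by (auto simp: cube_maps_def continuous_map_def)
  then have "(u, g \<circ> (f \<circ> u)) \<in> cube_homotopic n X x"
    by (intro cube_homotopic_equal[OF u(1)]) (simp add: gf)
  then show "homotopy_group_map n X g (f x) (homotopy_group_map n Y f x C) = C"
    unfolding u(2) homotopy_group_map_class[OF f u(1)] homotopy_group_map_class[OF g fu] gf[OF x]
    by (rule cube_homotopic_class_eq[symmetric])
qed

text \<open>
  Needed to compare different homeomorphic copies of the same space inside an equivalence system.
\<close>

lemma homeomorphic_maps_weak_homotopy_equivalence:
  assumes "homeomorphic_maps X Y f g"
  shows "weak_homotopy_equivalence X Y f"
proof -
  have f: "continuous_map X Y f" and g: "continuous_map Y X g"
    and gf: "\<And>x. x \<in> topspace X \<Longrightarrow> g (f x) = x" and fg: "\<And>y. y \<in> topspace Y \<Longrightarrow> f (g y) = y"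
    using assms by (auto simp: homeomorphic_maps_def)
  have "bij_betw (homotopy_group_map n Y f x) (homotopy_group_set n X x) (homotopy_group_set n Y (f x))"
    if x: "x \<in> topspace X" for n x
  proof -
    have fx: "f x \<in> topspace Y" using f x by (auto simp: continuous_map_def)
    note 1 = homotopy_group_map_left_inverse[OF f g gf x]
      and 2 = homotopy_group_map_left_inverse[OF g f fg fx, unfolded gf[OF x]]
    show ?thesis
    proof (rule bij_betw_byWitness[where f' = "homotopy_group_map n X g (f x)"])
      show "homotopy_group_map n Y f x ` homotopy_group_set n X x \<subseteq> homotopy_group_set n Y (f x)"
        using 1(1) by (rule image_subsetI)
      show "homotopy_group_map n X g (f x) ` homotopy_group_set n Y (f x) \<subseteq> homotopy_group_set n X x"
        using 2(1) by (rule image_subsetI)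
    qed (intro ballI 1(2) 2(2); assumption)+
  qed
  then show ?thesis
    unfolding weak_homotopy_equivalence_def using f homeomorphic_maps_pi0_bijective[OF assms] by blast
qed

section \<open>Equivalence systems on arbitrary spaces\<close>

locale equivalence_family =
  fixes F :: "'u morphism_family"
  assumes equivalences: "equivalence_system F"
begin

lemma F_continuous: "F S T f \<Longrightarrow> continuous_map S T f"
  using equivalences[unfolded equivalence_system_def, THEN conjunct1] by simp

lemma
  assumes "continuous_map S T f" "continuous_map T U g"
  shows F_compose: "F S T f \<Longrightarrow> F T U g \<Longrightarrow> F S U (g \<circ> f)"
    and F_cancel_right: "F S T f \<Longrightarrow> F S U (g \<circ> f) \<Longrightarrow> F T U g"
    and F_cancel_left: "F T U g \<Longrightarrow> F S U (g \<circ> f) \<Longrightarrow> F S T f"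
  using equivalences[unfolded equivalence_system_def, THEN conjunct2, THEN conjunct1,
      rule_format, of S T f U g] assms by simp_all

lemma F_homotopic: "homotopic_with (\<lambda>_. True) S T f g \<Longrightarrow> F S T f \<Longrightarrow> F S T g"
  using equivalences[unfolded equivalence_system_def, THEN conjunct2, THEN conjunct2,
      THEN conjunct1] by simp

lemma F_weak_homotopy_equivalence: "weak_homotopy_equivalence S T f \<Longrightarrow> F S T f"
  using equivalences[unfolded equivalence_system_def, THEN conjunct2, THEN conjunct2,
      THEN conjunct2, THEN conjunct1] by simp

lemma F_pi0_bijective: "F S T f \<Longrightarrow> pi0_bijective S T f"
  using equivalences[unfolded equivalence_system_def, THEN conjunct2, THEN conjunct2,
      THEN conjunct2, THEN conjunct2, THEN conjunct1] by simp

lemma F_cong: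
  assumes "F S T f" "\<And>x. x \<in> topspace S \<Longrightarrow> f x = g x"
  shows "F S T g"
proof (rule F_homotopic[OF _ assms(1)])
  show "homotopic_with (\<lambda>_. True) S T f g"
    by (rule homotopic_with_equal) (use F_continuous[OF assms(1)] assms(2) in auto)
qed

text \<open>
  Any two copies of a map differ by homeomorphisms on both sides, which are members of the
  family; so 2-out-of-3 lets membership pass from one copy to the other.
\<close>

lemma F_transport:
  assumes f: "continuous_map S T f"
    and h: "homeomorphic_maps S S' h h'" and k: "homeomorphic_maps T T' k k'"
    and h1: "homeomorphic_maps S S1 h1 h1'" and k1: "homeomorphic_maps T T1 k1 k1'"
    and Ff: "F S1 T1 (k1 \<circ> f \<circ> h1')"
  shows "F S' T' (k \<circ> f \<circ> h')"
proof -
  note hm = homeomorphic_maps_def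
  have h1s: "homeomorphic_maps S1 S h1' h1" and k1s: "homeomorphic_maps T1 T k1' k1"
    using h1 k1 homeomorphic_maps_sym[THEN iffD1] by blast+
  have hh: "homeomorphic_maps S1 S' (h \<circ> h1') (h1 \<circ> h')"
    by (rule homeomorphic_maps_compose[OF conjI[OF h1s h]])
  have kk: "homeomorphic_maps T1 T' (k \<circ> k1') (k1 \<circ> k')"
    by (rule homeomorphic_maps_compose[OF conjI[OF k1s k]])
  note Fh = F_weak_homotopy_equivalence[OF homeomorphic_maps_weak_homotopy_equivalence[OF hh]]
  note Fk = F_weak_homotopy_equivalence[OF homeomorphic_maps_weak_homotopy_equivalence[OF kk]]
  have c: "continuous_map S1 S' (h \<circ> h1')" "continuous_map T1 T' (k \<circ> k1')"
    using hh kk unfolding hm by blast+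
  have h1': "continuous_map S1 S h1'" using h1 unfolding hm by blast
  have "continuous_map S' S h'" "continuous_map T T' k" using h k unfolding hm by blast+
  then have cf: "continuous_map S' T' (k \<circ> f \<circ> h')"
    using f by (meson continuous_map_compose)
  have "F S1 T' ((k \<circ> k1') \<circ> (k1 \<circ> f \<circ> h1'))"
    by (rule F_compose[OF F_continuous[OF Ff] c(2) Ff Fk])
  then have "F S1 T' ((k \<circ> f \<circ> h') \<circ> (h \<circ> h1'))"
  proof (rule F_cong)
    fix x assume "x \<in> topspace S1"
    then have x: "h1' x \<in> topspace S" using h1' by (auto simp: continuous_map_def)
    then have "f (h1' x) \<in> topspace T" using f by (auto simp: continuous_map_def)
    then show "((k \<circ> k1') \<circ> (k1 \<circ> f \<circ> h1')) x = ((k \<circ> f \<circ> h') \<circ> (h \<circ> h1')) x"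
      using x h k1 by (simp add: hm)
  qed
  then show ?thesis by (rule F_cancel_right[OF c(1) cf Fh])
qed

lemma F_equivalence_iff:
  assumes "continuous_map S T f"
    and "homeomorphic_maps S S' h h'" and "homeomorphic_maps T T' k k'"
  shows "F_equivalence F S T f \<longleftrightarrow> F S' T' (k \<circ> f \<circ> h')"
  unfolding F_equivalence_def using F_transport[OF assms] assms(2,3) by blast

lemma copies_compose:
  assumes "homeomorphic_maps S S' h h'" "homeomorphic_maps T T' k k'" "homeomorphic_maps U U' l l'"
    and f: "continuous_map S T f" and g: "continuous_map T U g"
  shows "F S' U' (l \<circ> (g \<circ> f) \<circ> h') \<longleftrightarrow> F S' U' ((l \<circ> g \<circ> k') \<circ> (k \<circ> f \<circ> h'))"
proof -
  have "(l \<circ> (g \<circ> f) \<circ> h') x = ((l \<circ> g \<circ> k') \<circ> (k \<circ> f \<circ> h')) x" if "x \<in> topspace S'" for x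
  proof -
    have "h' x \<in> topspace S"
      using assms(1) that by (auto simp: homeomorphic_maps_def continuous_map_def)
    then have "f (h' x) \<in> topspace T" using f by (auto simp: continuous_map_def)
    then show ?thesis using assms(2) by (simp add: homeomorphic_maps_def)
  qed
  then show ?thesis using F_cong[of S' U'] by metis
qed

text \<open>
  The 2-out-of-3 property, for spaces over arbitrary types. Each of the spaces involved occurs in
  one of the two given equivalences and therefore has a copy in the universe of \<open>F\<close>.
\<close>

lemma
  assumes f: "continuous_map S T f" and g: "continuous_map T U g"
  shows F_equivalence_compose:
      "F_equivalence F S T f \<Longrightarrow> F_equivalence F T U g \<Longrightarrow> F_equivalence F S U (g \<circ> f)"
    and F_equivalence_cancel_right:
      "F_equivalence F S T f \<Longrightarrow> F_equivalence F S U (g \<circ> f) \<Longrightarrow> F_equivalence F T U g"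
    and F_equivalence_cancel_left:
      "F_equivalence F T U g \<Longrightarrow> F_equivalence F S U (g \<circ> f) \<Longrightarrow> F_equivalence F S T f"
proof -
  have "(F_equivalence F S T f \<and> F_equivalence F T U g \<longrightarrow> F_equivalence F S U (g \<circ> f)) \<and>
      (F_equivalence F S T f \<and> F_equivalence F S U (g \<circ> f) \<longrightarrow> F_equivalence F T U g) \<and>
      (F_equivalence F T U g \<and> F_equivalence F S U (g \<circ> f) \<longrightarrow> F_equivalence F S T f)"
    (is ?thesis)
    if S: "homeomorphic_maps S S' h h'" and T: "homeomorphic_maps T T' k k'"
      and U: "homeomorphic_maps U U' l l'" for S' T' U' :: "'u topology" and h h' k k' l l'
  proof -
    note gf = continuous_map_compose[OF f g]
    have c: "continuous_map S' T' (k \<circ> f \<circ> h')" "continuous_map T' U' (l \<circ> g \<circ> k')"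
      using S T U f g unfolding homeomorphic_maps_def by (meson continuous_map_compose)+
    show ?thesis
      unfolding F_equivalence_iff[OF f S T] F_equivalence_iff[OF g T U]
        F_equivalence_iff[OF gf S U] copies_compose[OF S T U f g]
      using F_compose[OF c] F_cancel_right[OF c] F_cancel_left[OF c] by blast
  qed
  note * = this
  show "F_equivalence F S T f \<Longrightarrow> F_equivalence F T U g \<Longrightarrow> F_equivalence F S U (g \<circ> f)"
    and "F_equivalence F S T f \<Longrightarrow> F_equivalence F S U (g \<circ> f) \<Longrightarrow> F_equivalence F T U g"
    and "F_equivalence F T U g \<Longrightarrow> F_equivalence F S U (g \<circ> f) \<Longrightarrow> F_equivalence F S T f"
    using * by (simp_all only: F_equivalence_def[of F S T] F_equivalence_def[of F T U]
      F_equivalence_def[of F S U]) meson+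
qed

lemma F_equivalence_homotopic:
  assumes fg: "homotopic_with (\<lambda>_. True) S T f g"
  shows "F_equivalence F S T f \<longleftrightarrow> F_equivalence F S T g"
proof -
  have "F_equivalence F S T g"
    if fg: "homotopic_with (\<lambda>_. True) S T f g" and Ff: "F_equivalence F S T f" for f g
  proof -
    obtain S' T' h h' k k' where h: "homeomorphic_maps S S' h h'" and k: "homeomorphic_maps T T' k k'"
      and F': "F S' T' (k \<circ> f \<circ> h')" using Ff by (auto simp: F_equivalence_def)
    have "homotopic_with (\<lambda>_. True) S T' (k \<circ> f) (k \<circ> g)"
      using homotopic_with_compose_continuous_map_left[OF fg, of T' k] k by (auto simp: homeomorphic_maps_def)
    then have "homotopic_with (\<lambda>_. True) S' T' (k \<circ> f \<circ> h') (k \<circ> g \<circ> h')"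
      using homotopic_with_compose_continuous_map_right[of _ S T' "k \<circ> f" "k \<circ> g" S' h'] h
      by (auto simp: homeomorphic_maps_def)
    then have "F S' T' (k \<circ> g \<circ> h')" using F_homotopic F' by blast
    then show ?thesis unfolding F_equivalence_def using h k by blast
  qed
  then show ?thesis using fg homotopic_with_symD by blast
qed

lemma F_equivalence_pi0_bijective:
  assumes FE: "F_equivalence F S T f"
  shows "\<exists>\<phi>. bij_betw \<phi> (path_components_of S) (path_components_of T)"
proof -
  obtain S' T' h h' k k' where h: "homeomorphic_maps S S' h h'" and k: "homeomorphic_maps T T' k k'"
    and F': "F S' T' (k \<circ> f \<circ> h')" using FE by (auto simp: F_equivalence_def)
  have k': "homeomorphic_maps T' T k' k" using k homeomorphic_maps_sym[THEN iffD1] by blast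
  note b1 = homeomorphic_maps_pi0_bijective[OF h, unfolded pi0_bijective_def]
    and b2 = F_pi0_bijective[OF F', unfolded pi0_bijective_def]
    and b3 = homeomorphic_maps_pi0_bijective[OF k', unfolded pi0_bijective_def]
  show ?thesis using bij_betw_trans[OF bij_betw_trans[OF b1 b2] b3] by blast
qed

lemma F_equivalence_nonempty:
  assumes "F_equivalence F S T f" "topspace T \<noteq> {}"
  shows "topspace S \<noteq> {}"
proof -
  have "path_components_of T \<noteq> {}" using assms(2) by (simp add: path_components_of_eq_empty)
  then have "path_components_of S \<noteq> {}"
    using F_equivalence_pi0_bijective[OF assms(1)] by (metis bij_betw_empty2 bij_betw_def image_is_empty)
  then show ?thesis by (auto simp: path_components_of_def)
qed

text \<open>
  Applied to a space of d-paths with fixed ends: all of them are homotopic through d-paths.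
\<close>

lemma F_contractible_path_component:
  assumes "F_contractible F S" "x \<in> topspace S" "y \<in> topspace S"
  shows "path_component_of S x y"
proof -
  obtain \<phi> where \<phi>: "bij_betw \<phi> (path_components_of S) (path_components_of (discrete_topology {()}))"
    using F_equivalence_pi0_bijective assms(1) unfolding F_contractible_def by blast
  have one: "C = {()}" if "C \<in> path_components_of (discrete_topology {()})" for C
    using that path_components_of_subset nonempty_path_components_of by fastforce
  have "path_component_of_set S u \<in> path_components_of S" if "u \<in> topspace S" for u
    using that by (auto simp: path_components_of_def)
  then have "path_component_of_set S x = path_component_of_set S y"
    using \<phi> assms(2,3) one bij_betw_apply[OF \<phi>] bij_betw_imp_inj_on[OF \<phi>] by (metis inj_onD)
  then show ?thesis using assms(2,3) path_component_of_equiv[of S x y] by (auto dest: Collect_inj)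
qed

lemma F_contractible_iff:
  assumes f: "continuous_map S T f" and "F_equivalence F S T f"
  shows "F_contractible F T \<longleftrightarrow> F_contractible F S"
proof -
  have c: "continuous_map T (discrete_topology {()}) (\<lambda>_. ())" by simp
  have eq: "(\<lambda>_. ()) \<circ> f = (\<lambda>_. ())" by auto
  show ?thesis
    using F_equivalence_compose[OF f c assms(2)] F_equivalence_cancel_right[OF f c assms(2)]
    unfolding F_contractible_def eq by blast
qed

end

section \<open>Extension of d-paths up to homotopy\<close>

text \<open>
  \<open>L \<alpha> z\<close> and \<open>R x \<beta>\<close> are the one-sided versions of stability: the extension by \<open>\<alpha>\<close> of paths with
  target \<open>z\<close>, and the extension by \<open>\<beta>\<close> of paths with source \<open>x\<close>.
\<close>

locale dspace_with_equivalences = equivalence_family F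
  for F :: "'u morphism_family" +
  fixes X :: "'a dspace"
  assumes d_space: "d_space X"
begin

abbreviation P :: "'a \<Rightarrow> 'a \<Rightarrow> (real \<Rightarrow> 'a) topology" where
  "P \<equiv> dpath_space X"

abbreviation L :: "(real \<Rightarrow> 'a) \<Rightarrow> 'a \<Rightarrow> bool" where
  "L \<alpha> z \<equiv> F_equivalence F (P (\<alpha> 1) z) (P (\<alpha> 0) z) (concat_path \<alpha>)"

abbreviation R :: "'a \<Rightarrow> (real \<Rightarrow> 'a) \<Rightarrow> bool" where
  "R x \<beta> \<equiv> F_equivalence F (P x (\<beta> 0)) (P x (\<beta> 1)) (\<lambda>\<omega>. concat_path \<omega> \<beta>)"

lemma dpaths_paths: "\<alpha> \<in> dpaths X \<Longrightarrow> \<alpha> \<in> paths (underlying X)"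
  using d_space by (auto simp: d_space_def)

lemma dpath_in_topspace:
  assumes "\<alpha> \<in> dpaths X" "u \<in> {0..1}" shows "\<alpha> u \<in> topspace (underlying X)"
  using dpaths_paths[OF assms(1)] assms(2) by (auto simp: paths_def pathin_def continuous_map_def)

lemma dpaths_from_to_iff: "\<alpha> \<in> dpaths_from_to X x y \<longleftrightarrow> \<alpha> \<in> dpaths X \<and> \<alpha> 0 = x \<and> \<alpha> 1 = y"
  using dpath_in_topspace by (auto simp: dpaths_between_def dpaths_in_def)

lemma topspace_dpath_space: "topspace (P x y) = dpaths_from_to X x y"
  using dpaths_paths by (auto simp: dpath_space_def dpaths_from_to_iff)

lemma in_dpath_space: "\<omega> \<in> topspace (P x y) \<longleftrightarrow> \<omega> \<in> dpaths X \<and> \<omega> 0 = x \<and> \<omega> 1 = y"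
  by (simp add: topspace_dpath_space dpaths_from_to_iff)

lemma const_dpath: "x \<in> topspace (underlying X) \<Longrightarrow> const_path x \<in> dpaths X"
  using d_space by (auto simp: d_space_def)

lemma concat_dpath: "\<alpha> \<in> dpaths X \<Longrightarrow> \<beta> \<in> dpaths X \<Longrightarrow> \<alpha> 1 = \<beta> 0 \<Longrightarrow> concat_path \<alpha> \<beta> \<in> dpaths X"
  using d_space by (auto simp: d_space_def)

lemma reparam_dpath:
  "\<alpha> \<in> dpaths X \<Longrightarrow> continuous_on {0..1} \<phi> \<Longrightarrow> mono_on {0..1} \<phi> \<Longrightarrow> \<phi> ` {0..1} \<subseteq> {0..1}
    \<Longrightarrow> restrict (\<alpha> \<circ> \<phi>) {0..1} \<in> dpaths X"
  using d_space unfolding d_space_def by blast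

lemma concat_path_ends [simp]: "concat_path \<alpha> \<beta> 0 = \<alpha> 0" "concat_path \<alpha> \<beta> 1 = \<beta> 1"
  by (auto simp: concat_path_def)

lemma const_path_ends [simp]: "const_path x 0 = x" "const_path x 1 = x"
  by (auto simp: const_path_def)

lemma continuous_map_dpath_space_iff:
  "continuous_map W (P x y) p \<longleftrightarrow> continuous_map W (path_space (underlying X)) p \<and>
    (\<forall>w\<in>topspace W. p w \<in> dpaths X \<and> p w 0 = x \<and> p w 1 = y)"
  by (auto simp: dpath_space_def continuous_map_in_subtopology image_subset_iff dpaths_from_to_iff Pi_iff)

lemma continuous_map_concat_dpath:
  assumes "continuous_map W (P x y) p" "continuous_map W (P y z) q"
  shows "continuous_map W (P x z) (\<lambda>w. concat_path (p w) (q w))"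
  using assms continuous_map_concat_path[of W "underlying X" p q]
  unfolding continuous_map_dpath_space_iff by (auto simp: concat_dpath)

lemma continuous_map_const_dpath:
  "\<alpha> \<in> dpaths X \<Longrightarrow> \<alpha> 0 = x \<Longrightarrow> \<alpha> 1 = y \<Longrightarrow> continuous_map W (P x y) (\<lambda>_. \<alpha>)"
  by (simp add: in_dpath_space)

lemma continuous_left: "\<alpha> \<in> dpaths X \<Longrightarrow> continuous_map (P (\<alpha> 1) z) (P (\<alpha> 0) z) (concat_path \<alpha>)"
  using continuous_map_concat_dpath[OF continuous_map_const_dpath continuous_map_id] by simp

lemma continuous_right:
  "\<beta> \<in> dpaths X \<Longrightarrow> continuous_map (P x (\<beta> 0)) (P x (\<beta> 1)) (\<lambda>\<omega>. concat_path \<omega> \<beta>)"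
  using continuous_map_concat_dpath[OF continuous_map_id continuous_map_const_dpath] by simp

text \<open>
  All coherence homotopies come from here. Interpolating linearly between the identity and a
  monotone reparametrization of the interval stays monotone, hence stays among d-paths.
\<close>

lemma homotopic_reparam:
  assumes p: "continuous_map W (P x y) p"
    and \<phi>: "continuous_on {0..1} \<phi>" "mono_on {0..1} \<phi>" "\<phi> 0 = 0" "\<phi> 1 = 1"
    and q: "\<And>w u. w \<in> topspace W \<Longrightarrow> u \<in> {0..1} \<Longrightarrow> q w u = p w (\<phi> u)"
    and ext: "\<And>w. w \<in> topspace W \<Longrightarrow> q w \<in> extensional {0..1}"
  shows "homotopic_with (\<lambda>_. True) W (P x y) p q"
proof -
  let ?I = "top_of_set {0..1::real}"
  have \<phi>01: "0 \<le> \<phi> u \<and> \<phi> u \<le> 1" if "0 \<le> u" "u \<le> 1" for u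
    using mono_onD[OF \<phi>(2), of 0 u] mono_onD[OF \<phi>(2), of u 1] \<phi>(3,4) that by auto
  define \<tau> where "\<tau> s u = (1 - s) * u + s * \<phi> u" for s u
  have \<tau>01: "0 \<le> \<tau> s u \<and> \<tau> s u \<le> 1" if "0 \<le> u" "u \<le> 1" "0 \<le> s" "s \<le> 1" for s u
    using that \<phi>01[OF that(1,2)] unfolding \<tau>_def
    by (intro conjI convex_bound_le) auto
  define h where "h = (\<lambda>(s, w). \<lambda>u\<in>{0..1}. p w (\<tau> s u))"
  have "continuous_map (prod_topology ?I W) (P x y) h"
    unfolding continuous_map_dpath_space_iff
  proof
    have 1: "continuous_map (prod_topology ?I W) (path_space (underlying X)) (\<lambda>v. p (snd v))"
    proof -
      have "continuous_map W (path_space (underlying X)) p"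
        using p unfolding continuous_map_dpath_space_iff by blast
      from continuous_map_compose[OF continuous_map_snd this] show ?thesis by (simp add: o_def)
    qed
    let ?V = "prod_topology (prod_topology ?I W) ?I"
    have f: "continuous_map ?V ?I (\<lambda>v. fst (fst v))"
      using continuous_map_compose[OF continuous_map_fst continuous_map_fst] by (auto simp: o_def)
    have s: "continuous_map ?V ?I snd" by (rule continuous_map_snd)
    have "continuous_map ?I euclideanreal \<phi>" using \<phi>(1) by simp
    from continuous_map_compose[OF s this] have s\<phi>: "continuous_map ?V euclideanreal (\<lambda>v. \<phi> (snd v))"
      by (simp add: o_def)
    have "continuous_map ?V euclideanreal (\<lambda>v. \<tau> (fst (fst v)) (snd v))"
      unfolding \<tau>_def using continuous_map_into_fulltopology[OF f] continuous_map_into_fulltopology[OF s] s\<phi>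
      by (intro continuous_intros)
    then have 2: "continuous_map ?V ?I (\<lambda>(v, u). \<tau> (fst v) u)"
      using \<tau>01 by (auto simp: continuous_map_in_subtopology case_prod_unfold)
    show "continuous_map (prod_topology ?I W) (path_space (underlying X)) h"
      using continuous_map_reparam[OF 1 2] by (simp add: h_def case_prod_unfold)
    show "\<forall>v\<in>topspace (prod_topology ?I W). h v \<in> dpaths X \<and> h v 0 = x \<and> h v 1 = y"
    proof
      fix v assume v: "v \<in> topspace (prod_topology ?I W)"
      obtain s w where sw: "v = (s, w)" by fastforce
      have s: "0 \<le> s" "s \<le> 1" and w: "w \<in> topspace W" using v sw by auto
      have pw: "p w \<in> dpaths X" "p w 0 = x" "p w 1 = y"
        using p w unfolding continuous_map_dpath_space_iff by auto
      have "mono_on {0..1} (\<tau> s)"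
        unfolding \<tau>_def using s mono_onD[OF \<phi>(2)]
        by (intro mono_onI add_mono mult_left_mono) auto
      moreover have "continuous_on {0..1} (\<tau> s)"
        unfolding \<tau>_def using \<phi>(1) by (intro continuous_intros)
      ultimately have "restrict (p w \<circ> \<tau> s) {0..1} \<in> dpaths X"
        using reparam_dpath[OF pw(1)] \<tau>01 s by (metis atLeastAtMost_iff image_subsetI)
      then show "h v \<in> dpaths X \<and> h v 0 = x \<and> h v 1 = y"
        using pw \<phi>(3,4) by (simp add: h_def sw \<tau>_def o_def)
    qed
  qed
  moreover have "h (0, w) = p w" if "w \<in> topspace W" for w
  proof
    have "p w \<in> extensional {0..1}"
      using p that dpaths_paths unfolding continuous_map_dpath_space_iff by (auto simp: paths_def)
    then show "h (0, w) u = p w u" for u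
      by (auto simp: h_def \<tau>_def restrict_def extensional_def)
  qed
  moreover have "h (1, w) = q w" if "w \<in> topspace W" for w
  proof
    show "h (1, w) u = q w u" for u
      using q[OF that, of u] ext[OF that] by (auto simp: h_def \<tau>_def restrict_def extensional_def)
  qed
  ultimately show ?thesis by (subst homotopic_with) auto
qed

lemma concat_path_extensional: "concat_path \<alpha> \<beta> \<in> extensional {0..1}"
  by (simp add: concat_path_def)

lemma homotopic_concat_const_right:
  assumes p: "continuous_map W (P x y) p"
  shows "homotopic_with (\<lambda>_. True) W (P x y) p (\<lambda>w. concat_path (p w) (const_path y))"
proof (rule homotopic_reparam[OF p, where \<phi> = "\<lambda>u. min (2 * u) 1"])
  show "continuous_on {0..1} (\<lambda>u::real. min (2 * u) 1)" by (intro continuous_intros)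
  fix w and u :: real assume "w \<in> topspace W" "u \<in> {0..1}"
  then show "concat_path (p w) (const_path y) u = p w (min (2 * u) 1)"
    using p by (auto simp: concat_path_def const_path_def min_def continuous_map_dpath_space_iff)
qed (auto simp: concat_path_extensional intro!: mono_onI)

lemma homotopic_concat_const_left:
  assumes p: "continuous_map W (P x y) p"
  shows "homotopic_with (\<lambda>_. True) W (P x y) p (\<lambda>w. concat_path (const_path x) (p w))"
proof (rule homotopic_reparam[OF p, where \<phi> = "\<lambda>u. max (2 * u - 1) 0"])
  show "continuous_on {0..1} (\<lambda>u::real. max (2 * u - 1) 0)" by (intro continuous_intros)
  fix w and u :: real assume "w \<in> topspace W" "u \<in> {0..1}"
  then show "concat_path (const_path x) (p w) u = p w (max (2 * u - 1) 0)"
    using p by (auto simp: concat_path_def const_path_def max_def continuous_map_dpath_space_iff)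
qed (auto simp: concat_path_extensional intro!: mono_onI)

lemma homotopic_concat_assoc:
  assumes p: "continuous_map W (P x y) p" and q: "continuous_map W (P y z) q"
    and r: "continuous_map W (P z v) r"
  shows "homotopic_with (\<lambda>_. True) W (P x v)
    (\<lambda>w. concat_path (p w) (concat_path (q w) (r w))) (\<lambda>w. concat_path (concat_path (p w) (q w)) (r w))"
proof (rule homotopic_reparam[where \<phi> = "\<lambda>u. min (2 * u) (min (u + 1/4) (u/2 + 1/2))"])
  show "continuous_map W (P x v) (\<lambda>w. concat_path (p w) (concat_path (q w) (r w)))"
    by (rule continuous_map_concat_dpath[OF p continuous_map_concat_dpath[OF q r]])
  show "continuous_on {0..1} (\<lambda>u::real. min (2 * u) (min (u + 1/4) (u/2 + 1/2)))" by (intro continuous_intros) auto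
  fix w and u :: real assume w: "w \<in> topspace W" and u: "u \<in> {0..1}"
  then show "concat_path (concat_path (p w) (q w)) (r w) u
      = concat_path (p w) (concat_path (q w) (r w)) (min (2 * u) (min (u + 1/4) (u/2 + 1/2)))"
    by (auto simp: concat_path_def min_def field_simps) (simp add: diff_divide_distrib mult.commute)
qed (auto simp: concat_path_extensional intro!: mono_onI)

text \<open>
  The path that joins \<open>\<gamma>\<close> to \<open>\<delta>\<close> in the path space supplies the homotopy parameter.
\<close>

lemma homotopic_concat_path_component:
  assumes "path_component_of (P x y) \<gamma> \<delta>"
  shows "homotopic_with (\<lambda>_. True) (P y z) (P x z) (concat_path \<gamma>) (concat_path \<delta>)"
    and "homotopic_with (\<lambda>_. True) (P v x) (P v y) (\<lambda>\<omega>. concat_path \<omega> \<gamma>) (\<lambda>\<omega>. concat_path \<omega> \<delta>)"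
proof -
  let ?I = "top_of_set {0..1::real}"
  obtain g where g: "continuous_map ?I (P x y) g" "g 0 = \<gamma>" "g 1 = \<delta>"
    using assms by (auto simp: path_component_of_def pathin_def)
  have 1: "continuous_map (prod_topology ?I Y) (P x y) (\<lambda>v. g (fst v))" for Y :: "(real \<Rightarrow> 'a) topology"
    using continuous_map_compose[OF continuous_map_fst g(1)] by (simp add: o_def)
  have 2: "continuous_map (prod_topology ?I Y) Y snd" for Y :: "(real \<Rightarrow> 'a) topology"
    by (rule continuous_map_snd)
  show "homotopic_with (\<lambda>_. True) (P y z) (P x z) (concat_path \<gamma>) (concat_path \<delta>)"
    using continuous_map_concat_dpath[OF 1 2] g
    by (subst homotopic_with) (auto intro!: exI[of _ "\<lambda>v. concat_path (g (fst v)) (snd v)"])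
  show "homotopic_with (\<lambda>_. True) (P v x) (P v y) (\<lambda>\<omega>. concat_path \<omega> \<gamma>) (\<lambda>\<omega>. concat_path \<omega> \<delta>)"
    using continuous_map_concat_dpath[OF 2 1] g
    by (subst homotopic_with) (auto intro!: exI[of _ "\<lambda>v. concat_path (snd v) (g (fst v))"])
qed

lemma homotopic_with_concat_right:
  assumes "homotopic_with (\<lambda>_. True) W (P x (\<beta> 0)) p q" and "\<beta> \<in> dpaths X"
  shows "homotopic_with (\<lambda>_. True) W (P x (\<beta> 1))
      (\<lambda>w. concat_path (p w) \<beta>) (\<lambda>w. concat_path (q w) \<beta>)"
  using homotopic_with_compose_continuous_map_left[OF assms(1) continuous_right[OF assms(2)],
      of "\<lambda>_. True"] by (simp add: o_def)

text \<open>
  Two-sided extension is the composite of the one-sided ones: by definition in one order, and by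
  associativity up to homotopy in the other.
\<close>

lemma
  assumes \<alpha>: "\<alpha> \<in> dpaths X" and \<beta>: "\<beta> \<in> dpaths X"
  shows extension_left_right: "extension_in F X \<alpha> \<beta> \<longleftrightarrow>
      F_equivalence F (P (\<alpha> 1) (\<beta> 0)) (P (\<alpha> 0) (\<beta> 1)) ((\<lambda>\<omega>. concat_path \<omega> \<beta>) \<circ> concat_path \<alpha>)"
    and extension_right_left: "extension_in F X \<alpha> \<beta> \<longleftrightarrow>
      F_equivalence F (P (\<alpha> 1) (\<beta> 0)) (P (\<alpha> 0) (\<beta> 1)) (concat_path \<alpha> \<circ> (\<lambda>\<omega>. concat_path \<omega> \<beta>))"
proof -
  show "extension_in F X \<alpha> \<beta> \<longleftrightarrow>
      F_equivalence F (P (\<alpha> 1) (\<beta> 0)) (P (\<alpha> 0) (\<beta> 1)) ((\<lambda>\<omega>. concat_path \<omega> \<beta>) \<circ> concat_path \<alpha>)"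
    by (simp add: extension_in_def o_def)
  have "homotopic_with (\<lambda>_. True) (P (\<alpha> 1) (\<beta> 0)) (P (\<alpha> 0) (\<beta> 1))
    (\<lambda>\<omega>. concat_path \<alpha> (concat_path \<omega> \<beta>)) (\<lambda>\<omega>. concat_path (concat_path \<alpha> \<omega>) \<beta>)"
    using homotopic_concat_assoc[OF continuous_map_const_dpath[OF \<alpha> refl refl] continuous_map_id
        continuous_map_const_dpath[OF \<beta> refl refl]] by simp
  from F_equivalence_homotopic[OF this]
  show "extension_in F X \<alpha> \<beta> \<longleftrightarrow>
      F_equivalence F (P (\<alpha> 1) (\<beta> 0)) (P (\<alpha> 0) (\<beta> 1)) (concat_path \<alpha> \<circ> (\<lambda>\<omega>. concat_path \<omega> \<beta>))"
    by (simp add: extension_in_def o_def)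
qed

text \<open>
  2-out-of-3 in the square with corners \<open>P (\<alpha> 1) (\<beta> 0)\<close>, \<open>P (\<alpha> 0) (\<beta> 0)\<close>, \<open>P (\<alpha> 1) (\<beta> 1)\<close> and
  \<open>P (\<alpha> 0) (\<beta> 1)\<close>, whose diagonal is the two-sided extension.
\<close>

lemma
  assumes \<alpha>: "\<alpha> \<in> dpaths X" and \<beta>: "\<beta> \<in> dpaths X"
  shows extension_iff_R: "L \<alpha> (\<beta> 0) \<Longrightarrow> extension_in F X \<alpha> \<beta> \<longleftrightarrow> R (\<alpha> 0) \<beta>"
    and extension_iff_L: "R (\<alpha> 0) \<beta> \<Longrightarrow> extension_in F X \<alpha> \<beta> \<longleftrightarrow> L \<alpha> (\<beta> 0)"
    and extension_iff_L': "R (\<alpha> 1) \<beta> \<Longrightarrow> extension_in F X \<alpha> \<beta> \<longleftrightarrow> L \<alpha> (\<beta> 1)"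
    and extension_iff_R': "L \<alpha> (\<beta> 1) \<Longrightarrow> extension_in F X \<alpha> \<beta> \<longleftrightarrow> R (\<alpha> 1) \<beta>"
proof -
  note LR = F_equivalence_compose[OF continuous_left[OF \<alpha>] continuous_right[OF \<beta>]]
    F_equivalence_cancel_right[OF continuous_left[OF \<alpha>] continuous_right[OF \<beta>]]
    F_equivalence_cancel_left[OF continuous_left[OF \<alpha>] continuous_right[OF \<beta>]]
  note RL = F_equivalence_compose[OF continuous_right[OF \<beta>] continuous_left[OF \<alpha>]]
    F_equivalence_cancel_right[OF continuous_right[OF \<beta>] continuous_left[OF \<alpha>]]
    F_equivalence_cancel_left[OF continuous_right[OF \<beta>] continuous_left[OF \<alpha>]]
  show "L \<alpha> (\<beta> 0) \<Longrightarrow> extension_in F X \<alpha> \<beta> \<longleftrightarrow> R (\<alpha> 0) \<beta>"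
    and "R (\<alpha> 0) \<beta> \<Longrightarrow> extension_in F X \<alpha> \<beta> \<longleftrightarrow> L \<alpha> (\<beta> 0)"
    unfolding extension_left_right[OF assms] using LR by blast+
  show "R (\<alpha> 1) \<beta> \<Longrightarrow> extension_in F X \<alpha> \<beta> \<longleftrightarrow> L \<alpha> (\<beta> 1)"
    and "L \<alpha> (\<beta> 1) \<Longrightarrow> extension_in F X \<alpha> \<beta> \<longleftrightarrow> R (\<alpha> 1) \<beta>"
    unfolding extension_right_left[OF assms] using RL by blast+
qed

lemma extension_const_right:
  assumes \<alpha>: "\<alpha> \<in> dpaths X"
  shows "extension_in F X \<alpha> (const_path z) \<longleftrightarrow> L \<alpha> z"
  using F_equivalence_homotopic[OF homotopic_concat_const_right[OF continuous_left[OF \<alpha>, of z]]]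
  by (simp add: extension_in_def)

lemma extension_const_left:
  assumes \<beta>: "\<beta> \<in> dpaths X"
  shows "extension_in F X (const_path x) \<beta> \<longleftrightarrow> R x \<beta>"
proof -
  have "homotopic_with (\<lambda>_. True) (P x (\<beta> 0)) (P x (\<beta> 0)) (\<lambda>\<omega>. \<omega>) (\<lambda>\<omega>. concat_path (const_path x) \<omega>)"
    using homotopic_concat_const_left[OF continuous_map_id[unfolded id_def]] .
  from F_equivalence_homotopic[OF homotopic_with_concat_right[OF this \<beta>]]
  show ?thesis by (simp add: extension_in_def)
qed

lemma L_concat:
  assumes \<alpha>: "\<alpha> \<in> dpaths X" and \<gamma>: "\<gamma> \<in> dpaths X" and eq: "\<alpha> 1 = \<gamma> 0"
  shows "L (concat_path \<alpha> \<gamma>) z \<longleftrightarrow>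
    F_equivalence F (P (\<gamma> 1) z) (P (\<alpha> 0) z) (concat_path \<alpha> \<circ> concat_path \<gamma>)"
proof -
  have "homotopic_with (\<lambda>_. True) (P (\<gamma> 1) z) (P (\<alpha> 0) z)
    (\<lambda>\<omega>. concat_path \<alpha> (concat_path \<gamma> \<omega>)) (\<lambda>\<omega>. concat_path (concat_path \<alpha> \<gamma>) \<omega>)"
    using homotopic_concat_assoc[OF continuous_map_const_dpath[OF \<alpha> refl eq]
        continuous_map_const_dpath[OF \<gamma> refl refl] continuous_map_id] by simp
  from F_equivalence_homotopic[OF this] show ?thesis by (simp add: o_def)
qed

lemma R_concat:
  assumes \<gamma>: "\<gamma> \<in> dpaths X" and \<beta>: "\<beta> \<in> dpaths X" and eq: "\<gamma> 1 = \<beta> 0"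
  shows "R x (concat_path \<gamma> \<beta>) \<longleftrightarrow>
    F_equivalence F (P x (\<gamma> 0)) (P x (\<beta> 1)) ((\<lambda>\<omega>. concat_path \<omega> \<beta>) \<circ> (\<lambda>\<omega>. concat_path \<omega> \<gamma>))"
proof -
  have "homotopic_with (\<lambda>_. True) (P x (\<gamma> 0)) (P x (\<beta> 1))
    (\<lambda>\<omega>. concat_path \<omega> (concat_path \<gamma> \<beta>)) (\<lambda>\<omega>. concat_path (concat_path \<omega> \<gamma>) \<beta>)"
    using homotopic_concat_assoc[OF continuous_map_id continuous_map_const_dpath[OF \<gamma> refl eq]
        continuous_map_const_dpath[OF \<beta> refl refl]] by simp
  from F_equivalence_homotopic[OF this] show ?thesis by (simp add: o_def)
qed

lemma
  assumes \<alpha>: "\<alpha> \<in> dpaths X" and \<gamma>: "\<gamma> \<in> dpaths X" and eq: "\<alpha> 1 = \<gamma> 0"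
  shows L_concat_compose: "L \<alpha> z \<Longrightarrow> L \<gamma> z \<Longrightarrow> L (concat_path \<alpha> \<gamma>) z"
    and L_concat_left: "L (concat_path \<alpha> \<gamma>) z \<Longrightarrow> L \<gamma> z \<Longrightarrow> L \<alpha> z"
    and L_concat_right: "L (concat_path \<alpha> \<gamma>) z \<Longrightarrow> L \<alpha> z \<Longrightarrow> L \<gamma> z"
    and R_concat_compose: "R x \<alpha> \<Longrightarrow> R x \<gamma> \<Longrightarrow> R x (concat_path \<alpha> \<gamma>)"
    and R_concat_left: "R x (concat_path \<alpha> \<gamma>) \<Longrightarrow> R x \<gamma> \<Longrightarrow> R x \<alpha>"
    and R_concat_right: "R x (concat_path \<alpha> \<gamma>) \<Longrightarrow> R x \<alpha> \<Longrightarrow> R x \<gamma>"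
proof -
  have cL: "continuous_map (P (\<alpha> 1) z) (P (\<alpha> 0) z) (concat_path \<alpha>)"
      "continuous_map (P (\<gamma> 1) z) (P (\<alpha> 1) z) (concat_path \<gamma>)"
    using continuous_left[OF \<alpha>] continuous_left[OF \<gamma>] by (simp_all add: eq)
  have cR: "continuous_map (P x (\<alpha> 0)) (P x (\<gamma> 0)) (\<lambda>\<omega>. concat_path \<omega> \<alpha>)"
      "continuous_map (P x (\<gamma> 0)) (P x (\<gamma> 1)) (\<lambda>\<omega>. concat_path \<omega> \<gamma>)"
    using continuous_right[OF \<alpha>] continuous_right[OF \<gamma>] by (simp_all add: eq)
  show "L \<alpha> z \<Longrightarrow> L \<gamma> z \<Longrightarrow> L (concat_path \<alpha> \<gamma>) z"
    and "L (concat_path \<alpha> \<gamma>) z \<Longrightarrow> L \<gamma> z \<Longrightarrow> L \<alpha> z"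
    and "L (concat_path \<alpha> \<gamma>) z \<Longrightarrow> L \<alpha> z \<Longrightarrow> L \<gamma> z"
    unfolding L_concat[OF assms]
    using F_equivalence_compose[OF cL(2,1)] F_equivalence_cancel_right[OF cL(2,1)]
      F_equivalence_cancel_left[OF cL(2,1)] eq by simp_all
  show "R x \<alpha> \<Longrightarrow> R x \<gamma> \<Longrightarrow> R x (concat_path \<alpha> \<gamma>)"
    and "R x (concat_path \<alpha> \<gamma>) \<Longrightarrow> R x \<gamma> \<Longrightarrow> R x \<alpha>"
    and "R x (concat_path \<alpha> \<gamma>) \<Longrightarrow> R x \<alpha> \<Longrightarrow> R x \<gamma>"
    unfolding R_concat[OF assms]
    using F_equivalence_compose[OF cR] F_equivalence_cancel_right[OF cR]
      F_equivalence_cancel_left[OF cR] eq by simp_all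
qed

lemma
  assumes "\<gamma> \<in> dpaths X" "\<delta> \<in> dpaths X" "\<gamma> 0 = \<delta> 0" "\<gamma> 1 = \<delta> 1" "F_contractible F (P (\<gamma> 0) (\<gamma> 1))"
  shows contractible_L: "L \<gamma> z \<Longrightarrow> L \<delta> z" and contractible_R: "R x \<gamma> \<Longrightarrow> R x \<delta>"
proof -
  have "path_component_of (P (\<gamma> 0) (\<gamma> 1)) \<gamma> \<delta>"
    using F_contractible_path_component[OF assms(5)] assms(1-4) by (simp add: in_dpath_space)
  note h = homotopic_concat_path_component[OF this]
  show "L \<gamma> z \<Longrightarrow> L \<delta> z" and "R x \<gamma> \<Longrightarrow> R x \<delta>"
    using F_equivalence_homotopic[OF h(1)] F_equivalence_homotopic[OF h(2)] assms(3,4) by simp_all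
qed

lemma L_nonempty:
  assumes "\<alpha> \<in> dpaths X" "\<gamma> \<in> dpaths X" "\<gamma> 0 = \<alpha> 0" "L \<alpha> (\<gamma> 1)"
  shows "\<exists>\<delta>\<in>dpaths X. \<delta> 0 = \<alpha> 1 \<and> \<delta> 1 = \<gamma> 1"
proof -
  have "\<gamma> \<in> topspace (P (\<alpha> 0) (\<gamma> 1))" using assms by (simp add: in_dpath_space)
  then have "topspace (P (\<alpha> 1) (\<gamma> 1)) \<noteq> {}" using F_equivalence_nonempty[OF assms(4)] by blast
  then show ?thesis using in_dpath_space by blast
qed

lemma R_nonempty:
  assumes "\<beta> \<in> dpaths X" "\<gamma> \<in> dpaths X" "\<gamma> 1 = \<beta> 1" "R (\<gamma> 0) \<beta>"
  shows "\<exists>\<delta>\<in>dpaths X. \<delta> 0 = \<gamma> 0 \<and> \<delta> 1 = \<beta> 0"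
proof -
  have "\<gamma> \<in> topspace (P (\<gamma> 0) (\<beta> 1))" using assms by (simp add: in_dpath_space)
  then have "topspace (P (\<gamma> 0) (\<beta> 0)) \<noteq> {}" using F_equivalence_nonempty[OF assms(4)] by blast
  then show ?thesis using in_dpath_space by blast
qed

end

section \<open>The finest common coarsening of two partitions\<close>

definition share :: "'a set set \<Rightarrow> 'a set set \<Rightarrow> ('a \<times> 'a) set" where
  "share \<A> \<B> = {(x, y). \<exists>A\<in>\<A> \<union> \<B>. x \<in> A \<and> y \<in> A}"

text \<open>
  The blocks are indexed by the points of \<open>\<Union>\<A>\<close>; this is the whole space whenever \<open>\<A>\<close> is a cover.
\<close>

definition join :: "'a set set \<Rightarrow> 'a set set \<Rightarrow> 'a set set" where
  "join \<A> \<B> = (\<lambda>x. (share \<A> \<B>)\<^sup>* `` {x}) ` \<Union>\<A>"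

lemma share_rtrancl_sym: "(x, y) \<in> (share \<A> \<B>)\<^sup>* \<Longrightarrow> (y, x) \<in> (share \<A> \<B>)\<^sup>*"
proof -
  have "sym (share \<A> \<B>)"
    by (auto simp: share_def sym_def)
  then show "(x, y) \<in> (share \<A> \<B>)\<^sup>* \<Longrightarrow> (y, x) \<in> (share \<A> \<B>)\<^sup>*"
    by (meson sym_rtrancl symD)
qed

lemma join_member_subset:
  assumes "C \<in> join \<A> \<B>" "A \<in> \<A> \<union> \<B>" "x \<in> A" "x \<in> C"
  shows "A \<subseteq> C"
proof
  fix y assume "y \<in> A"
  then have "(x, y) \<in> share \<A> \<B>" using assms by (auto simp: share_def)
  with assms(1,4) show "y \<in> C" unfolding join_def by (auto intro: rtrancl_into_rtrancl)
qed

lemma join_connected: "C \<in> join \<A> \<B> \<Longrightarrow> x \<in> C \<Longrightarrow> y \<in> C \<Longrightarrow> (x, y) \<in> (share \<A> \<B>)\<^sup>*"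
  unfolding join_def by (auto intro: rtrancl_trans dest: share_rtrancl_sym)

lemma join_eqI: "C \<in> join \<A> \<B> \<Longrightarrow> C' \<in> join \<A> \<B> \<Longrightarrow> x \<in> C \<Longrightarrow> x \<in> C' \<Longrightarrow> C = C'"
  unfolding join_def by (auto intro: rtrancl_trans dest: share_rtrancl_sym)

lemma Union_join:
  assumes "\<Union>\<A> = T" "\<Union>\<B> = T"
  shows "\<Union>(join \<A> \<B>) = T"
proof
  have "y \<in> T" if "(x, y) \<in> (share \<A> \<B>)\<^sup>*" "x \<in> T" for x y
    using that by (induction rule: rtrancl_induct) (use assms in \<open>auto simp: share_def\<close>)
  then show "\<Union>(join \<A> \<B>) \<subseteq> T" using assms by (auto simp: join_def)
  show "T \<subseteq> \<Union>(join \<A> \<B>)" using assms by (auto simp: join_def)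
qed

lemma coarser_join:
  assumes "\<Union>\<A> = T" "\<Union>\<B> = T" "\<forall>A\<in>\<A> \<union> \<B>. A \<noteq> {}"
  shows "coarser (join \<A> \<B>) \<A>" "coarser (join \<A> \<B>) \<B>"
proof -
  have "\<exists>C\<in>join \<A> \<B>. A \<subseteq> C" if A: "A \<in> \<A> \<union> \<B>" for A
  proof -
    from A assms(3) obtain x where x: "x \<in> A" by blast
    then have "x \<in> \<Union>(join \<A> \<B>)" using A assms(1,2) Union_join[OF assms(1,2)] by blast
    then show ?thesis using join_member_subset[OF _ A x] by blast
  qed
  then show "coarser (join \<A> \<B>) \<A>" "coarser (join \<A> \<B>) \<B>" by (auto simp: coarser_def)
qed

section \<open>Abstract component systems\<close>

text \<open>
  The properties of d-paths that the argument uses, in a form that admits two models: d-paths in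
  the given direction, and d-paths with the roles of \<open>s\<close> and \<open>t\<close>, of left and right, exchanged.
  \<open>E \<alpha> \<beta>\<close> stands for "two-sided extension by \<open>\<alpha>\<close> and \<open>\<beta>\<close> is an equivalence", \<open>Lok \<alpha> z\<close> and \<open>Rok x \<beta>\<close>
  for the one-sided versions, and \<open>contr x y\<close> for "the space of paths from \<open>x\<close> to \<open>y\<close> is contractible".
\<close>

locale stable_paths =
  fixes T :: "'a set" and D :: "'p set" and s t :: "'p \<Rightarrow> 'a"
    and cmp :: "'p \<Rightarrow> 'p \<Rightarrow> 'p" and idp :: "'a \<Rightarrow> 'p"
    and E :: "'p \<Rightarrow> 'p \<Rightarrow> bool" and Lok :: "'p \<Rightarrow> 'a \<Rightarrow> bool" and Rok :: "'a \<Rightarrow> 'p \<Rightarrow> bool"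
    and contr :: "'a \<Rightarrow> 'a \<Rightarrow> bool"
  assumes src_tgt: "\<alpha> \<in> D \<Longrightarrow> s \<alpha> \<in> T \<and> t \<alpha> \<in> T"
    and idp: "x \<in> T \<Longrightarrow> idp x \<in> D \<and> s (idp x) = x \<and> t (idp x) = x"
    and cmp: "\<lbrakk>\<alpha> \<in> D; \<beta> \<in> D; t \<alpha> = s \<beta>\<rbrakk>
      \<Longrightarrow> cmp \<alpha> \<beta> \<in> D \<and> s (cmp \<alpha> \<beta>) = s \<alpha> \<and> t (cmp \<alpha> \<beta>) = t \<beta>"
    and E_idp_right: "\<lbrakk>\<alpha> \<in> D; z \<in> T\<rbrakk> \<Longrightarrow> E \<alpha> (idp z) \<longleftrightarrow> Lok \<alpha> z"
    and E_idp_left: "\<lbrakk>x \<in> T; \<beta> \<in> D\<rbrakk> \<Longrightarrow> E (idp x) \<beta> \<longleftrightarrow> Rok x \<beta>"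
    and E_iff: "\<lbrakk>\<alpha> \<in> D; \<beta> \<in> D; Lok \<alpha> (s \<beta>)\<rbrakk> \<Longrightarrow> E \<alpha> \<beta> \<longleftrightarrow> Rok (s \<alpha>) \<beta>"
    and Lok_move: "\<lbrakk>\<alpha> \<in> D; \<beta> \<in> D; Rok (s \<alpha>) \<beta>; Rok (t \<alpha>) \<beta>; Lok \<alpha> (t \<beta>)\<rbrakk> \<Longrightarrow> Lok \<alpha> (s \<beta>)"
    and Lok_cmp: "\<lbrakk>\<alpha> \<in> D; \<gamma> \<in> D; t \<alpha> = s \<gamma>; z \<in> T; Lok \<alpha> z; Lok \<gamma> z\<rbrakk> \<Longrightarrow> Lok (cmp \<alpha> \<gamma>) z"
    and Lok_cmp_left: "\<lbrakk>\<alpha> \<in> D; \<gamma> \<in> D; t \<alpha> = s \<gamma>; z \<in> T; Lok (cmp \<alpha> \<gamma>) z; Lok \<gamma> z\<rbrakk> \<Longrightarrow> Lok \<alpha> z"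
    and Lok_cmp_right: "\<lbrakk>\<alpha> \<in> D; \<gamma> \<in> D; t \<alpha> = s \<gamma>; z \<in> T; Lok (cmp \<alpha> \<gamma>) z; Lok \<alpha> z\<rbrakk> \<Longrightarrow> Lok \<gamma> z"
    and Lok_nonempty: "\<lbrakk>\<alpha> \<in> D; \<gamma> \<in> D; s \<gamma> = s \<alpha>; Lok \<alpha> (t \<gamma>)\<rbrakk> \<Longrightarrow> \<exists>\<delta>\<in>D. s \<delta> = t \<alpha> \<and> t \<delta> = t \<gamma>"
    and Lok_contr: "\<lbrakk>\<alpha> \<in> D; z \<in> T; Lok \<alpha> z\<rbrakk> \<Longrightarrow> contr (t \<alpha>) z \<longleftrightarrow> contr (s \<alpha>) z"
    and Rok_contr: "\<lbrakk>x \<in> T; \<beta> \<in> D; Rok x \<beta>; contr x (s \<beta>)\<rbrakk> \<Longrightarrow> contr x (t \<beta>)"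
    and contr_Lok: "\<lbrakk>\<gamma> \<in> D; \<delta> \<in> D; s \<gamma> = s \<delta>; t \<gamma> = t \<delta>; contr (s \<gamma>) (t \<gamma>); z \<in> T; Lok \<gamma> z\<rbrakk>
      \<Longrightarrow> Lok \<delta> z"
begin

definition le :: "'a \<Rightarrow> 'a \<Rightarrow> bool" where
  "le x y \<longleftrightarrow> (\<exists>\<alpha>\<in>D. s \<alpha> = x \<and> t \<alpha> = y)"

definition order_convex :: "'a set \<Rightarrow> bool" where
  "order_convex A \<longleftrightarrow> (\<forall>x\<in>A. \<forall>z\<in>A. \<forall>y. le x y \<longrightarrow> le y z \<longrightarrow> y \<in> A)"

definition directed :: "'a set \<Rightarrow> bool" where
  "directed A \<longleftrightarrow> (\<forall>x\<in>A. \<forall>y\<in>A. \<exists>z\<in>A. le x z \<and> le y z)"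

text \<open>
  For a convex \<open>A\<close>, a d-path lies in \<open>A\<close> and above \<open>z\<close> iff its ends lie in \<open>A\<close> and its source is above
  \<open>z\<close>; this is why images of paths need not be mentioned.
\<close>

definition St :: "'p \<Rightarrow> 'a set \<Rightarrow> 'a set" where
  "St \<alpha> A = {z \<in> A. \<forall>\<beta>\<in>D. s \<beta> \<in> A \<longrightarrow> t \<beta> \<in> A \<longrightarrow> le z (s \<beta>) \<longrightarrow> E \<alpha> \<beta>}"

definition stable :: "'a set \<Rightarrow> 'a set \<Rightarrow> bool" where
  "stable A B \<longleftrightarrow> (\<forall>\<alpha>\<in>D. s \<alpha> \<in> A \<longrightarrow> t \<alpha> \<in> A \<longrightarrow> St \<alpha> B \<noteq> {})"

definition system :: "'a set set \<Rightarrow> bool" where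
  "system \<A> \<longleftrightarrow> pairwise disjnt \<A> \<and> \<Union>\<A> = T \<and>
     (\<forall>A\<in>\<A>. order_convex A \<and> directed A \<and> (\<exists>a\<in>A. \<exists>z\<in>St (idp a) A. contr a z)) \<and>
     (\<forall>A\<in>\<A>. \<forall>B\<in>\<A>. stable A B)"

text \<open>
  For a directed \<open>Z\<close> this is truth far out in \<open>Z\<close>, and it is stable under conjunction.
\<close>

definition eventually_in :: "'a set \<Rightarrow> ('a \<Rightarrow> bool) \<Rightarrow> bool" where
  "eventually_in Z P \<longleftrightarrow> (\<exists>z\<in>Z. \<forall>z'\<in>Z. le z z' \<longrightarrow> P z')"

definition Lst :: "'p \<Rightarrow> 'a set \<Rightarrow> bool" where
  "Lst \<alpha> Z \<longleftrightarrow> eventually_in Z (Lok \<alpha>)"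

definition Rst :: "'a \<Rightarrow> 'a set \<Rightarrow> bool" where
  "Rst x Z \<longleftrightarrow> (\<exists>z\<in>Z. \<forall>\<beta>\<in>D. s \<beta> \<in> Z \<longrightarrow> t \<beta> \<in> Z \<longrightarrow> le z (s \<beta>) \<longrightarrow> Rok x \<beta>)"

lemma leI: "\<alpha> \<in> D \<Longrightarrow> le (s \<alpha>) (t \<alpha>)"
  by (auto simp: le_def)

lemma le_T: "le x y \<Longrightarrow> x \<in> T \<and> y \<in> T"
  using src_tgt by (auto simp: le_def)

lemma le_refl: "x \<in> T \<Longrightarrow> le x x"
  using idp by (auto simp: le_def)

lemma le_trans: "le x y \<Longrightarrow> le y z \<Longrightarrow> le x z"
  unfolding le_def using cmp by metis

lemma directedD: "directed A \<Longrightarrow> x \<in> A \<Longrightarrow> y \<in> A \<Longrightarrow> \<exists>z\<in>A. le x z \<and> le y z"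
  by (auto simp: directed_def)

lemma eventually_in_conj:
  assumes "directed Z" "eventually_in Z P" "eventually_in Z Q"
  shows "eventually_in Z (\<lambda>z. P z \<and> Q z)"
proof -
  obtain p q where p: "p \<in> Z" "\<forall>z\<in>Z. le p z \<longrightarrow> P z" and q: "q \<in> Z" "\<forall>z\<in>Z. le q z \<longrightarrow> Q z"
    using assms(2,3) by (auto simp: eventually_in_def)
  obtain r where "r \<in> Z" "le p r" "le q r" using directedD[OF assms(1) p(1) q(1)] by blast
  then show ?thesis unfolding eventually_in_def using p q le_trans by blast
qed

lemma eventually_in_mono:
  "eventually_in Z P \<Longrightarrow> (\<And>z. z \<in> Z \<Longrightarrow> P z \<Longrightarrow> Q z) \<Longrightarrow> eventually_in Z Q"
  by (auto simp: eventually_in_def)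

lemma eventually_in_mp2:
  assumes "directed Z" "eventually_in Z P" "eventually_in Z Q"
    "\<And>z. z \<in> Z \<Longrightarrow> P z \<Longrightarrow> Q z \<Longrightarrow> R z"
  shows "eventually_in Z R"
  using eventually_in_mono[OF eventually_in_conj[OF assms(1-3)]] assms(4) by blast

lemma eventually_in_above: "z \<in> Z \<Longrightarrow> le x z \<Longrightarrow> eventually_in Z (le x)"
  unfolding eventually_in_def using le_trans by blast

lemma eventually_in_ex:
  assumes "Z \<subseteq> T" "eventually_in Z P" shows "\<exists>z\<in>Z. P z"
  using assms le_refl by (auto simp: eventually_in_def)

text \<open>
  Left stability is tested by constant paths \<open>\<beta>\<close>; once left extension by \<open>\<alpha>\<close> is an equivalence,
  two-sided extension is one iff right extension is. The converse needs a common upper bound.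
\<close>

lemma St_nonempty_iff:
  assumes Z: "directed Z" "Z \<subseteq> T" and \<alpha>: "\<alpha> \<in> D"
  shows "St \<alpha> Z \<noteq> {} \<longleftrightarrow> Lst \<alpha> Z \<and> Rst (s \<alpha>) Z"
proof
  assume "St \<alpha> Z \<noteq> {}"
  then obtain z where z: "z \<in> Z"
    and E: "\<And>\<beta>. \<beta> \<in> D \<Longrightarrow> s \<beta> \<in> Z \<Longrightarrow> t \<beta> \<in> Z \<Longrightarrow> le z (s \<beta>) \<Longrightarrow> E \<alpha> \<beta>"
    by (auto simp: St_def)
  have L: "Lok \<alpha> z'" if "z' \<in> Z" "le z z'" for z'
    using E[of "idp z'"] idp[of z'] E_idp_right[OF \<alpha>, of z'] that Z(2) by auto
  moreover have "Rok (s \<alpha>) \<beta>" if "\<beta> \<in> D" "s \<beta> \<in> Z" "t \<beta> \<in> Z" "le z (s \<beta>)" for \<beta>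
    using E[OF that] E_iff[OF \<alpha> that(1) L] that by blast
  ultimately show "Lst \<alpha> Z \<and> Rst (s \<alpha>) Z"
    unfolding Lst_def Rst_def eventually_in_def using z by blast
next
  assume "Lst \<alpha> Z \<and> Rst (s \<alpha>) Z"
  then obtain p q where p: "p \<in> Z" "\<forall>z\<in>Z. le p z \<longrightarrow> Lok \<alpha> z"
    and q: "q \<in> Z" "\<forall>\<beta>\<in>D. s \<beta> \<in> Z \<longrightarrow> t \<beta> \<in> Z \<longrightarrow> le q (s \<beta>) \<longrightarrow> Rok (s \<alpha>) \<beta>"
    unfolding Lst_def Rst_def eventually_in_def by blast
  obtain r where r: "r \<in> Z" "le p r" "le q r" using directedD[OF Z(1) p(1) q(1)] by blast
  have "E \<alpha> \<beta>" if "\<beta> \<in> D" "s \<beta> \<in> Z" "t \<beta> \<in> Z" "le r (s \<beta>)" for \<beta>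
    using that p q r le_trans E_iff[OF \<alpha> that(1)] by blast
  then show "St \<alpha> Z \<noteq> {}" using r(1) by (auto simp: St_def)
qed

lemma directed_finite_bound:
  assumes "directed B" "B \<noteq> {}" "finite S" "S \<subseteq> B"
  shows "\<exists>u\<in>B. \<forall>x\<in>S. le x u"
  using assms(3,4)
proof (induction rule: finite_induct)
  case empty
  then show ?case using assms(2) by blast
next
  case (insert x S)
  then obtain u where u: "u \<in> B" "\<forall>x\<in>S. le x u" by blast
  obtain v where "v \<in> B" "le x v" "le u v" using directedD[OF assms(1) _ u(1)] insert.prems by blast
  then show ?case using u le_trans by blast
qed

text \<open>
  If each member \<open>A\<close> missed all points above some \<open>f A\<close>, an upper bound of these finitely many
  points would lie in no member.
\<close>

lemma finite_cover_cofinal: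
  assumes "directed B" "B \<noteq> {}" "finite \<A>" "B \<subseteq> \<Union>\<A>"
  shows "\<exists>A\<in>\<A>. \<forall>b\<in>B. \<exists>c\<in>A \<inter> B. le b c"
proof (rule ccontr)
  assume "\<not> ?thesis"
  then obtain f where f: "\<And>A. A \<in> \<A> \<Longrightarrow> f A \<in> B \<and> (\<forall>c\<in>A \<inter> B. \<not> le (f A) c)" by metis
  obtain u where u: "u \<in> B" "\<forall>x\<in>f ` \<A>. le x u"
    using directed_finite_bound[OF assms(1,2), of "f ` \<A>"] assms(3) f by blast
  then show False using f assms(4) by blast
qed

text \<open>
  Far out in \<open>Z\<close>, the space of paths from \<open>t \<delta>\<close> is equivalent to the one from \<open>s \<delta>\<close>, hence nonempty
  if the latter is.
\<close>

lemma Lst_reach: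
  assumes Z: "directed Z" "Z \<subseteq> T" and \<delta>: "\<delta> \<in> D" "Lst \<delta> Z"
  shows "(\<exists>z\<in>Z. le (s \<delta>) z) \<longleftrightarrow> (\<exists>z\<in>Z. le (t \<delta>) z)"
proof
  assume "\<exists>z\<in>Z. le (s \<delta>) z"
  then have ev: "eventually_in Z (le (s \<delta>))" using eventually_in_above by blast
  have "eventually_in Z (le (t \<delta>))"
  proof (rule eventually_in_mp2[OF Z(1) ev \<delta>(2)[unfolded Lst_def]])
    fix z assume "le (s \<delta>) z" "Lok \<delta> z"
    then show "le (t \<delta>) z" using Lok_nonempty[OF \<delta>(1)] unfolding le_def by metis
  qed
  then show "\<exists>z\<in>Z. le (t \<delta>) z" using eventually_in_ex[OF Z(2)] by blast
qed (use leI[OF \<delta>(1)] le_trans in blast)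

text \<open>
  Induction along a chain of overlapping members. Two points of the same member need not be
  comparable, but they have a common upper bound in it.
\<close>

lemma share_invariant:
  assumes dir: "\<forall>A\<in>\<A> \<union> \<B>. directed A"
    and step: "\<And>A \<delta>. A \<in> \<A> \<union> \<B> \<Longrightarrow> \<delta> \<in> D \<Longrightarrow> s \<delta> \<in> A \<Longrightarrow> t \<delta> \<in> A \<Longrightarrow> P (s \<delta>) \<longleftrightarrow> P (t \<delta>)"
    and xy: "(x, y) \<in> (share \<A> \<B>)\<^sup>*"
  shows "P x \<longleftrightarrow> P y"
  using xy
proof (induction rule: rtrancl_induct)
  case (step y z)
  then obtain A where A: "A \<in> \<A> \<union> \<B>" "y \<in> A" "z \<in> A" by (auto simp: share_def)
  then obtain w where w: "w \<in> A" "le y w" "le z w" using dir directedD by metis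
  have "P u \<longleftrightarrow> P w" if "u \<in> A" "le u w" for u
    using assms(2)[OF A(1)] that w(1) unfolding le_def by metis
  then show ?case using step.IH A w by blast
qed simp

lemma
  assumes "system \<A>"
  shows system_cover: "\<Union>\<A> = T"
    and system_subset: "A \<in> \<A> \<Longrightarrow> A \<subseteq> T"
    and system_convex: "A \<in> \<A> \<Longrightarrow> order_convex A"
    and system_directed: "A \<in> \<A> \<Longrightarrow> directed A"
    and system_contr: "A \<in> \<A> \<Longrightarrow> \<exists>a\<in>A. \<exists>z\<in>St (idp a) A. contr a z"
    and system_nonempty: "A \<in> \<A> \<Longrightarrow> A \<noteq> {}"
    and system_disjoint: "A \<in> \<A> \<Longrightarrow> A' \<in> \<A> \<Longrightarrow> x \<in> A \<Longrightarrow> x \<in> A' \<Longrightarrow> A = A'"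
  using assms unfolding system_def pairwise_def disjnt_def by blast+

lemma system_Lst:
  assumes "system \<A>" "A \<in> \<A>" "B \<in> \<A>" "\<alpha> \<in> D" "s \<alpha> \<in> A" "t \<alpha> \<in> A"
  shows "Lst \<alpha> B"
proof -
  have "St \<alpha> B \<noteq> {}" using assms unfolding system_def stable_def by blast
  then show ?thesis
    using St_nonempty_iff system_directed system_subset assms by blast
qed

text \<open>
  Right stability of a point comes from the constant path at it, which lies in some member.
\<close>

lemma system_Rst:
  assumes "system \<A>" "B \<in> \<A>" "x \<in> T"
  shows "Rst x B"
proof -
  obtain A where A: "A \<in> \<A>" "x \<in> A" using system_cover[OF assms(1)] assms(3) by blast
  have "St (idp x) B \<noteq> {}"
    using assms A idp[OF assms(3)] unfolding system_def stable_def by metis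
  then show ?thesis
    using St_nonempty_iff[OF system_directed system_subset] idp[OF assms(3)] assms by metis
qed

text \<open>
  On the members of a system this is a partial order, because reaching a member is a
  property shared by all points of another one.
\<close>

definition below :: "'a set \<Rightarrow> 'a set \<Rightarrow> bool" where
  "below A B \<longleftrightarrow> (\<exists>x\<in>A. \<exists>y\<in>B. le x y)"

lemma belowD:
  assumes "system \<A>" "A \<in> \<A>" "B \<in> \<A>" "below A B" "x \<in> A"
  shows "\<exists>y\<in>B. le x y"
proof -
  obtain a b where a: "a \<in> A" "b \<in> B" "le a b" using assms(4) by (auto simp: below_def)
  have "(a, x) \<in> (share {A} {})\<^sup>*" using a assms(5) by (auto simp: share_def)
  then have "(\<exists>z\<in>B. le a z) \<longleftrightarrow> (\<exists>z\<in>B. le x z)"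
    by (rule share_invariant[rotated 2, where P = "\<lambda>x. \<exists>z\<in>B. le x z"])
      (use Lst_reach[OF system_directed[OF assms(1,3)] system_subset[OF assms(1,3)]]
        system_Lst[OF assms(1-3)] system_directed[OF assms(1,2)] in auto)
  then show ?thesis using a by blast
qed

lemma below_trans:
  assumes "system \<A>" "A \<in> \<A>" "B \<in> \<A>" "C \<in> \<A>" "below A B" "below B C"
  shows "below A C"
  using belowD[OF assms(1,3,4,6)] assms(5) le_trans unfolding below_def by blast

lemma below_antisym:
  assumes "system \<A>" "A \<in> \<A>" "B \<in> \<A>" "below A B" "below B A"
  shows "A = B"
proof -
  obtain x where "x \<in> A" using system_nonempty[OF assms(1,2)] by blast
  then obtain y where y: "y \<in> B" "le x y" using belowD[OF assms(1-4)] by blast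
  then obtain z where "z \<in> A" "le y z" using belowD[OF assms(1,3,2,5)] by blast
  then have "y \<in> A" using system_convex[OF assms(1,2)] \<open>x \<in> A\<close> y unfolding order_convex_def by blast
  then show ?thesis using system_disjoint[OF assms(1-3)] y by blast
qed

section \<open>The common coarsening of two component systems\<close>

text \<open>
  The members of \<open>\<A>\<close> that serve as ends: each \<open>B \<in> \<B>\<close> meeting \<open>Z\<close> has cofinally many points in \<open>Z\<close>,
  so by convexity it stays in \<open>Z\<close> from some point on.
\<close>

definition terminal :: "'a set set \<Rightarrow> 'a set set \<Rightarrow> 'a set \<Rightarrow> bool" where
  "terminal \<A> \<B> Z \<longleftrightarrow> Z \<in> \<A> \<and> (\<forall>B\<in>\<B>. B \<inter> Z \<noteq> {} \<longrightarrow> (\<forall>b\<in>B. \<exists>c\<in>Z \<inter> B. le b c))"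

context
  fixes \<A> \<B> :: "'a set set"
  assumes A: "system \<A>" and B: "system \<B>" and fin: "finite \<A>"
begin

lemma members_directed: "\<forall>A\<in>\<A> \<union> \<B>. directed A"
  using A B system_directed by blast

text \<open>
  A maximal member \<open>Z\<close> of \<open>\<A>\<close> inside \<open>C\<close> works. If \<open>B'\<close> meets \<open>Z\<close>, finiteness of \<open>\<A>\<close> gives a member \<open>Y\<close>
  that is cofinal in \<open>B'\<close>; it lies above \<open>Z\<close> and inside \<open>C\<close>, so it is \<open>Z\<close>.
\<close>

lemma terminal_exists:
  assumes C: "C \<in> join \<A> \<B>"
  shows "\<exists>Z. terminal \<A> \<B> Z \<and> Z \<subseteq> C"
proof -
  let ?S = "{A \<in> \<A>. A \<subseteq> C}"
  let ?R = "\<lambda>A A'. A \<noteq> A' \<and> below A A'"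
  obtain x A where x: "x \<in> C" "A \<in> \<A>" "x \<in> A" using C by (auto simp: join_def)
  then have "A \<subseteq> C" using join_member_subset[OF C] by blast
  then have ne: "?S \<noteq> {}" using x by blast
  have "asymp_on ?S ?R" by (rule asymp_onI) (use below_antisym[OF A] in auto)
  moreover have "transp_on ?S ?R"
    by (rule transp_onI) (use below_antisym[OF A] below_trans[OF A] in blast)
  moreover have "finite ?S" using fin by simp
  ultimately have "\<exists>Z\<in>?S. \<forall>Y\<in>?S. Y \<noteq> Z \<longrightarrow> \<not> ?R Z Y"
    using ne by (intro Finite_Set.bex_max_element)
  then obtain Z where Z: "Z \<in> ?S" "\<And>Y. Y \<in> ?S \<Longrightarrow> below Z Y \<Longrightarrow> Y = Z" by auto
  have "\<exists>c\<in>Z \<inter> B'. le b c" if B': "B' \<in> \<B>" "p \<in> B'" "p \<in> Z" "b \<in> B'" for B' p b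
  proof -
    have "B' \<subseteq> C" using join_member_subset[OF C] B' Z by blast
    obtain Y where Y: "Y \<in> \<A>" "\<forall>b\<in>B'. \<exists>c\<in>Y \<inter> B'. le b c"
      using finite_cover_cofinal[OF system_directed[OF B B'(1)] _ fin] B' system_cover[OF A]
        system_subset[OF B] by blast
    then obtain c where c: "c \<in> Y" "c \<in> B'" "le p c" using B' by blast
    have "Y \<subseteq> C" using join_member_subset[OF C _ c(1)] Y(1) c(2) \<open>B' \<subseteq> C\<close> by blast
    then have "Y = Z" using Z(2) Y(1) c B' by (auto simp: below_def)
    then show ?thesis using Y B' by blast
  qed
  then show ?thesis using Z(1) unfolding terminal_def by blast
qed

lemma
  assumes "terminal \<A> \<B> Z"
  shows terminal_mem: "Z \<in> \<A>" and terminal_directed: "directed Z"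
    and terminal_convex: "order_convex Z" and terminal_subset: "Z \<subseteq> T"
  using assms system_directed[OF A] system_convex[OF A] system_subset[OF A]
  by (auto simp: terminal_def)

text \<open>
  The decisive transfer of stability from \<open>\<B>\<close> to an end in \<open>\<A>\<close>.
\<close>

lemma Lst_terminal_other:
  assumes Z: "terminal \<A> \<B> Z" and D: "\<delta> \<in> D" "s \<delta> \<in> B'" "t \<delta> \<in> B'" and B': "B' \<in> \<B>"
  shows "Lst \<delta> Z"
proof -
  note dirZ = terminal_directed[OF Z]
  obtain p q where p: "p \<in> Z" "\<forall>\<beta>\<in>D. s \<beta> \<in> Z \<longrightarrow> t \<beta> \<in> Z \<longrightarrow> le p (s \<beta>) \<longrightarrow> Rok (s \<delta>) \<beta>"
    and q: "q \<in> Z" "\<forall>\<beta>\<in>D. s \<beta> \<in> Z \<longrightarrow> t \<beta> \<in> Z \<longrightarrow> le q (s \<beta>) \<longrightarrow> Rok (t \<delta>) \<beta>"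
    using system_Rst[OF A terminal_mem[OF Z], of "s \<delta>"]
      system_Rst[OF A terminal_mem[OF Z], of "t \<delta>"] src_tgt[OF D(1)]
    unfolding Rst_def by blast
  obtain r where r: "r \<in> Z" "le p r" "le q r" using directedD[OF dirZ p(1) q(1)] by blast
  \<comment> \<open>From \<open>z\<close> one can move within \<open>Z\<close> along some \<open>\<beta>\<close> to a point \<open>c\<close> that lies far out in the member
    \<open>B''\<close> of \<open>z\<close>. There \<open>\<delta>\<close> is stable because \<open>\<B>\<close> is a system, and right extension by \<open>\<beta>\<close> is an
    equivalence at both ends of \<open>\<delta>\<close> because \<open>\<A>\<close> is a system.\<close>
  have "Lok \<delta> z" if z: "z \<in> Z" "le r z" for z
  proof -
    obtain B'' where B'': "B'' \<in> \<B>" "z \<in> B''"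
      using system_cover[OF B] terminal_subset[OF Z] z by blast
    obtain b where b: "b \<in> B''" "\<forall>b'\<in>B''. le b b' \<longrightarrow> Lok \<delta> b'"
      using system_Lst[OF B B' B''(1) D] unfolding Lst_def eventually_in_def by blast
    obtain b' where b': "b' \<in> B''" "le b b'" "le z b'"
      using directedD[OF system_directed[OF B B''(1)] b(1) B''(2)] by blast
    obtain c where c: "c \<in> Z" "c \<in> B''" "le b' c"
      using Z B'' z b' unfolding terminal_def by blast
    obtain \<beta> where \<beta>: "\<beta> \<in> D" "s \<beta> = z" "t \<beta> = c"
      using le_trans[OF b'(3) c(3)] by (auto simp: le_def)
    have "Lok \<delta> c" using b(2) c le_trans[OF b'(2) c(3)] by blast
    then show ?thesis
      using Lok_move[OF D(1) \<beta>(1)] p(2) q(2) \<beta> z c r le_trans by blast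
  qed
  then show ?thesis unfolding Lst_def eventually_in_def using r(1) by blast
qed

lemma Lst_terminal:
  assumes Z: "terminal \<A> \<B> Z" and "A' \<in> \<A> \<union> \<B>" "\<delta> \<in> D" "s \<delta> \<in> A'" "t \<delta> \<in> A'"
  shows "Lst \<delta> Z"
  using assms Lst_terminal_other[OF Z] system_Lst[OF A _ terminal_mem[OF Z]] by blast

lemma reach_invariant:
  assumes "terminal \<A> \<B> Z" "C \<in> join \<A> \<B>" "x \<in> C" "y \<in> C"
  shows "(\<exists>z\<in>Z. le x z) \<longleftrightarrow> (\<exists>z\<in>Z. le y z)"
  by (rule share_invariant[OF members_directed _ join_connected[OF assms(2-4)],
        where P = "\<lambda>x. \<exists>z\<in>Z. le x z"])
    (use Lst_reach[OF terminal_directed[OF assms(1)] terminal_subset[OF assms(1)]]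
      Lst_terminal[OF assms(1)] in blast)

lemma reach_terminal:
  assumes "terminal \<A> \<B> Z" "Z \<subseteq> C" "C \<in> join \<A> \<B>" "x \<in> C"
  shows "\<exists>z\<in>Z. le x z"
proof -
  obtain z where z: "z \<in> Z" using system_nonempty[OF A terminal_mem[OF assms(1)]] by blast
  then have "le z z" using le_refl terminal_subset[OF assms(1)] by blast
  then show ?thesis using reach_invariant[OF assms(1,3), of z x] z assms by blast
qed

text \<open>
  If \<open>x \<le> y \<le> z\<close> with \<open>x\<close> and \<open>z\<close> in \<open>C\<close>, then \<open>C\<close> reaches the end of the class of \<open>y\<close> and that class
  reaches the end of \<open>C\<close>. So the two ends are below each other and coincide.
\<close>

lemma join_convex:
  assumes C: "C \<in> join \<A> \<B>"
  shows "order_convex C"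
  unfolding order_convex_def
proof (intro ballI allI impI)
  fix x z y assume xz: "x \<in> C" "z \<in> C" and le: "le x y" "le y z"
  obtain C1 where C1: "C1 \<in> join \<A> \<B>" "y \<in> C1"
    using le_T[OF le(1)] Union_join[OF system_cover[OF A] system_cover[OF B]] by blast
  obtain Z where Z: "terminal \<A> \<B> Z" "Z \<subseteq> C" using terminal_exists[OF C] by blast
  obtain Z1 where Z1: "terminal \<A> \<B> Z1" "Z1 \<subseteq> C1" using terminal_exists[OF C1(1)] by blast
  obtain a where a: "a \<in> Z" using system_nonempty[OF A terminal_mem[OF Z(1)]] by blast
  obtain b where b: "b \<in> Z1" using system_nonempty[OF A terminal_mem[OF Z1(1)]] by blast
  have "\<exists>z\<in>Z1. le x z" using reach_terminal[OF Z1 C1] le le_trans by blast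
  then have "below Z Z1" using reach_invariant[OF Z1(1) C xz(1), of a] a Z by (auto simp: below_def)
  moreover have "\<exists>z\<in>Z. le y z" using reach_terminal[OF Z C xz(2)] le le_trans by blast
  then have "below Z1 Z"
    using reach_invariant[OF Z(1) C1, of b] b Z1 by (auto simp: below_def)
  ultimately have "Z = Z1"
    using below_antisym[OF A terminal_mem[OF Z(1)] terminal_mem[OF Z1(1)]] by blast
  then show "y \<in> C" using join_eqI[OF C C1(1), of a] a Z Z1 C1 by blast
qed

lemma join_directed:
  assumes C: "C \<in> join \<A> \<B>"
  shows "directed C"
  unfolding directed_def
proof (intro ballI)
  fix x y assume xy: "x \<in> C" "y \<in> C"
  obtain Z where Z: "terminal \<A> \<B> Z" "Z \<subseteq> C" using terminal_exists[OF C] by blast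
  obtain a where a: "a \<in> Z" "le x a" using reach_terminal[OF Z C xy(1)] by blast
  obtain b where b: "b \<in> Z" "le y b" using reach_terminal[OF Z C xy(2)] by blast
  obtain c where "c \<in> Z" "le a c" "le b c"
    using directedD[OF terminal_directed[OF Z(1)] a(1) b(1)] by blast
  then show "\<exists>z\<in>C. le x z \<and> le y z" using a b Z(2) le_trans by blast
qed

text \<open>
  Nothing in the class of an end lies beyond it. Hence far out in the class means far out in its
  end, and stability with respect to the end is stability with respect to the class.
\<close>

lemma terminal_upper:
  assumes "terminal \<A> \<B> Z" "Z \<subseteq> C" "C \<in> join \<A> \<B>" "z \<in> Z" "u \<in> C" "le z u"
  shows "u \<in> Z"
  using reach_terminal[OF assms(1-3,5)] terminal_convex[OF assms(1)] assms(4,6)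
  unfolding order_convex_def by blast

lemma St_terminal:
  assumes Z: "terminal \<A> \<B> Z" "Z \<subseteq> C" "C \<in> join \<A> \<B>"
  shows "St \<alpha> Z \<subseteq> St \<alpha> C"
proof
  fix z assume z: "z \<in> St \<alpha> Z"
  then have zZ: "z \<in> Z" by (simp add: St_def)
  have "E \<alpha> \<beta>" if "\<beta> \<in> D" "s \<beta> \<in> C" "t \<beta> \<in> C" "le z (s \<beta>)" for \<beta>
    using terminal_upper[OF Z zZ that(2,4)]
      terminal_upper[OF Z zZ that(3) le_trans[OF that(4) leI[OF that(1)]]] z that
    by (auto simp: St_def)
  then show "z \<in> St \<alpha> C" using zZ Z by (auto simp: St_def)
qed

text \<open>
  True at one point of \<open>Z\<close> and one target, since \<open>Z\<close> is trivial. Right extensions move the target up,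
  and left stability moves the source through the class.
\<close>

lemma contr_eventually:
  assumes Z: "terminal \<A> \<B> Z" "Z \<subseteq> C" "C \<in> join \<A> \<B>" and x: "x \<in> C"
  shows "eventually_in Z (contr x)"
proof -
  note dirZ = terminal_directed[OF Z(1)] and subZ = terminal_subset[OF Z(1)]
  obtain a z where a: "a \<in> Z" and z: "z \<in> St (idp a) Z" and az: "contr a z"
    using system_contr[OF A terminal_mem[OF Z(1)]] by blast
  have zZ: "z \<in> Z" and aT: "a \<in> T" using z a subZ by (auto simp: St_def)
  have "contr a z'" if z': "z' \<in> Z" "le z z'" for z'
  proof -
    obtain \<beta> where \<beta>: "\<beta> \<in> D" "s \<beta> = z" "t \<beta> = z'" using z' by (auto simp: le_def)
    have "le z z" using zZ subZ le_refl by blast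
    then have "Rok a \<beta>" using z \<beta> zZ z' E_idp_left[OF aT \<beta>(1)] by (auto simp: St_def)
    then show ?thesis using Rok_contr[OF aT \<beta>(1)] az \<beta> by blast
  qed
  then have "eventually_in Z (contr a)" unfolding eventually_in_def using zZ by blast
  moreover have "eventually_in Z (contr x) \<longleftrightarrow> eventually_in Z (contr a)"
  proof (rule share_invariant[OF members_directed _ join_connected[OF Z(3) x],
        where P = "\<lambda>x. eventually_in Z (contr x)"])
    fix A' \<delta> assume \<delta>: "A' \<in> \<A> \<union> \<B>" "\<delta> \<in> D" "s \<delta> \<in> A'" "t \<delta> \<in> A'"
    have ev: "eventually_in Z (Lok \<delta>)" using Lst_terminal[OF Z(1) \<delta>] by (simp add: Lst_def)
    have iff: "contr (t \<delta>) z \<longleftrightarrow> contr (s \<delta>) z" if "z \<in> Z" "Lok \<delta> z" for z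
      using Lok_contr[OF \<delta>(2) _ that(2)] that(1) subZ by blast
    show "eventually_in Z (contr (s \<delta>)) \<longleftrightarrow> eventually_in Z (contr (t \<delta>))"
    proof
      assume "eventually_in Z (contr (s \<delta>))"
      from eventually_in_mp2[OF dirZ ev this] show "eventually_in Z (contr (t \<delta>))" by (simp add: iff)
    next
      assume "eventually_in Z (contr (t \<delta>))"
      from eventually_in_mp2[OF dirZ ev this] show "eventually_in Z (contr (s \<delta>))" by (simp add: iff)
    qed
  qed (use a Z in blast)
  ultimately show ?thesis by blast
qed

lemma Lst_cmp:
  assumes Z: "directed Z" "Z \<subseteq> T" and D: "\<alpha> \<in> D" "\<gamma> \<in> D" "t \<alpha> = s \<gamma>"
  shows "Lst \<alpha> Z \<Longrightarrow> Lst \<gamma> Z \<Longrightarrow> Lst (cmp \<alpha> \<gamma>) Z"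
    and "Lst (cmp \<alpha> \<gamma>) Z \<Longrightarrow> Lst \<gamma> Z \<Longrightarrow> Lst \<alpha> Z"
    and "Lst (cmp \<alpha> \<gamma>) Z \<Longrightarrow> Lst \<alpha> Z \<Longrightarrow> Lst \<gamma> Z"
  unfolding Lst_def
  by (erule (1) eventually_in_mp2[OF Z(1)],
      use Lok_cmp[OF D] Lok_cmp_left[OF D] Lok_cmp_right[OF D] Z(2) in blast)+

text \<open>
  At points of \<open>Z\<close> this is the stability of the pair \<open>(Z, Z1)\<close>, since paths between points of \<open>Z\<close> stay
  in \<open>Z\<close>. From there it spreads along the class.
\<close>

lemma Lst_to_terminal:
  assumes C: "C \<in> join \<A> \<B>" and Z: "terminal \<A> \<B> Z" "Z \<subseteq> C" and Z1: "terminal \<A> \<B> Z1"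
    and x: "x \<in> C"
  shows "\<forall>\<gamma>\<in>D. s \<gamma> = x \<longrightarrow> t \<gamma> \<in> Z \<longrightarrow> Lst \<gamma> Z1"
proof -
  define good where "good x \<longleftrightarrow> x \<in> C \<longrightarrow> (\<forall>\<gamma>\<in>D. s \<gamma> = x \<longrightarrow> t \<gamma> \<in> Z \<longrightarrow> Lst \<gamma> Z1)" for x
  note dirZ = terminal_directed[OF Z(1)] and subZ = terminal_subset[OF Z(1)]
  note cmp_iff = Lst_cmp[OF terminal_directed[OF Z1] terminal_subset[OF Z1]]
  obtain a where a: "a \<in> Z" using system_nonempty[OF A terminal_mem[OF Z(1)]] by blast
  have ZZ1: "Lst \<kappa> Z1" if "\<kappa> \<in> D" "s \<kappa> \<in> Z" "t \<kappa> \<in> Z" for \<kappa>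
    using system_Lst[OF A terminal_mem[OF Z(1)] terminal_mem[OF Z1] that] .
  have "good a" using ZZ1 a by (auto simp: good_def)
  moreover have "good x \<longleftrightarrow> good a"
  proof (rule share_invariant[OF members_directed _ join_connected[OF C x]])
    fix A' \<delta> assume A': "A' \<in> \<A> \<union> \<B>" and \<delta>: "\<delta> \<in> D" and st: "s \<delta> \<in> A'" "t \<delta> \<in> A'"
    have L\<delta>: "Lst \<delta> Z1" using Lst_terminal[OF Z1 A' \<delta> st] .
    have mem: "s \<delta> \<in> C \<longleftrightarrow> t \<delta> \<in> C" using join_member_subset[OF C A'] st by blast
    show "good (s \<delta>) \<longleftrightarrow> good (t \<delta>)"
    proof
      \<comment> \<open>Here \<open>\<delta>\<close> followed by \<open>\<gamma>\<close> is a path from \<open>s \<delta>\<close>, and one can cancel \<open>\<delta>\<close>.\<close>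
      assume g: "good (s \<delta>)"
      have "Lst \<gamma> Z1" if C': "t \<delta> \<in> C" and \<gamma>: "\<gamma> \<in> D" "s \<gamma> = t \<delta>" "t \<gamma> \<in> Z" for \<gamma>
      proof -
        have "Lst (cmp \<delta> \<gamma>) Z1"
          using g cmp[OF \<delta> \<gamma>(1)] \<gamma> mem C' by (auto simp: good_def)
        then show ?thesis using cmp_iff(3)[OF \<delta> \<gamma>(1)] \<gamma> L\<delta> by simp
      qed
      then show "good (t \<delta>)" by (auto simp: good_def)
    next
      \<comment> \<open>Conversely, a path \<open>\<gamma>\<close> from \<open>s \<delta>\<close> need not factor through \<open>\<delta>\<close>. But after prolonging it by \<open>\<kappa>\<close> to
        a point \<open>c\<close> to which the space of paths from \<open>s \<delta>\<close> is contractible, it is homotopic to one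
        that does, and \<open>\<kappa>\<close> can be cancelled again.\<close>
      assume g: "good (t \<delta>)"
      have "Lst \<gamma> Z1" if C': "s \<delta> \<in> C" and \<gamma>: "\<gamma> \<in> D" "s \<gamma> = s \<delta>" "t \<gamma> \<in> Z" for \<gamma>
      proof -
        have "eventually_in Z (\<lambda>c. contr (s \<delta>) c \<and> le (t \<delta>) c \<and> le (t \<gamma>) c)"
        proof (intro eventually_in_conj[OF dirZ])
          show "eventually_in Z (contr (s \<delta>))" using contr_eventually[OF Z C C'] .
          obtain z where "z \<in> Z" "le (t \<delta>) z" using reach_terminal[OF Z C] mem C' by blast
          then show "eventually_in Z (le (t \<delta>))" by (rule eventually_in_above)
          show "eventually_in Z (le (t \<gamma>))"
            using \<gamma>(3) subZ by (blast intro: eventually_in_above le_refl)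
        qed
        then obtain c where c: "c \<in> Z" "contr (s \<delta>) c" "le (t \<delta>) c" "le (t \<gamma>) c"
          using eventually_in_ex[OF subZ] by blast
        obtain \<kappa> where \<kappa>: "\<kappa> \<in> D" "s \<kappa> = t \<gamma>" "t \<kappa> = c" using c(4) by (auto simp: le_def)
        obtain \<eta> where \<eta>: "\<eta> \<in> D" "s \<eta> = t \<delta>" "t \<eta> = c" using c(3) by (auto simp: le_def)
        have "Lst \<eta> Z1" using g mem C' \<eta> c(1) by (auto simp: good_def)
        then have "Lst (cmp \<delta> \<eta>) Z1" using cmp_iff(1)[OF \<delta> \<eta>(1)] \<eta> L\<delta> by simp
        then have "Lst (cmp \<gamma> \<kappa>) Z1"
          unfolding Lst_def
          by (rule eventually_in_mono)
            (use contr_Lok[of "cmp \<delta> \<eta>" "cmp \<gamma> \<kappa>"] cmp[OF \<delta> \<eta>(1)] cmp[OF \<gamma>(1) \<kappa>(1)] \<gamma> \<kappa> \<eta> c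
              terminal_subset[OF Z1] in auto)
        then show ?thesis using cmp_iff(2)[OF \<gamma>(1) \<kappa>(1)] \<kappa> ZZ1[OF \<kappa>(1)] c \<gamma> by simp
      qed
      then show "good (s \<delta>)" by (auto simp: good_def)
    qed
  qed (use a Z in blast)
  ultimately show ?thesis using x by (simp add: good_def)
qed

text \<open>
  A path inside \<open>C\<close> is prolonged into the end of \<open>C\<close>; the prolonging path and the prolonged one are
  both left stable, hence so is the path itself.
\<close>

lemma join_stable:
  assumes C: "C \<in> join \<A> \<B>" and C1: "C1 \<in> join \<A> \<B>"
  shows "stable C C1"
  unfolding stable_def
proof (intro ballI impI)
  fix \<alpha> assume \<alpha>: "\<alpha> \<in> D" "s \<alpha> \<in> C" "t \<alpha> \<in> C"
  obtain Z where Z: "terminal \<A> \<B> Z" "Z \<subseteq> C" using terminal_exists[OF C] by blast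
  obtain Z1 where Z1: "terminal \<A> \<B> Z1" "Z1 \<subseteq> C1" using terminal_exists[OF C1(1)] by blast
  note Z1' = terminal_directed[OF Z1(1)] terminal_subset[OF Z1(1)]
  obtain \<gamma> where \<gamma>: "\<gamma> \<in> D" "s \<gamma> = t \<alpha>" "t \<gamma> \<in> Z"
    using reach_terminal[OF Z C \<alpha>(3)] by (auto simp: le_def)
  have "Lst \<gamma> Z1" using Lst_to_terminal[OF C Z Z1(1) \<alpha>(3)] \<gamma> by blast
  moreover have "Lst (cmp \<alpha> \<gamma>) Z1"
    using Lst_to_terminal[OF C Z Z1(1) \<alpha>(2)] \<gamma> cmp[OF \<alpha>(1) \<gamma>(1)] by metis
  ultimately have "Lst \<alpha> Z1" using Lst_cmp(2)[OF Z1' \<alpha>(1) \<gamma>(1)] \<gamma> by simp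
  then have "St \<alpha> Z1 \<noteq> {}"
    using St_nonempty_iff[OF Z1' \<alpha>(1)] system_Rst[OF A terminal_mem[OF Z1(1)]] src_tgt[OF \<alpha>(1)]
    by blast
  then show "St \<alpha> C1 \<noteq> {}" using St_terminal[OF Z1 C1] by blast
qed

lemma system_join: "system (join \<A> \<B>)"
  unfolding system_def
proof (intro conjI ballI)
  show "pairwise disjnt (join \<A> \<B>)"
    unfolding pairwise_def disjnt_def using join_eqI by (metis disjoint_iff)
  show "\<Union> (join \<A> \<B>) = T" by (rule Union_join[OF system_cover[OF A] system_cover[OF B]])
  fix C assume C: "C \<in> join \<A> \<B>"
  obtain Z where Z: "terminal \<A> \<B> Z" "Z \<subseteq> C" using terminal_exists[OF C] by blast
  then show "\<exists>a\<in>C. \<exists>z\<in>St (idp a) C. contr a z"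
    using system_contr[OF A terminal_mem[OF Z(1)]] St_terminal[OF Z C] by blast
qed (use join_convex join_directed join_stable in auto)

end

lemma closed_coarser:
  assumes \<C>: "system \<C>" and \<A>: "system \<A>" "finite \<A>" and co: "coarser \<C> \<A>"
    and closed: "\<forall>A\<in>\<A>. \<exists>x\<in>A. \<forall>y\<in>A. le y x" and C: "C \<in> \<C>"
  shows "\<exists>x\<in>C. \<forall>y\<in>C. le y x"
proof -
  obtain f where f: "\<And>A. A \<in> \<A> \<Longrightarrow> f A \<in> A \<and> (\<forall>y\<in>A. le y (f A))" using closed by metis
  have "finite (f ` {A \<in> \<A>. A \<subseteq> C})" "f ` {A \<in> \<A>. A \<subseteq> C} \<subseteq> C" using \<A>(2) f by auto
  then obtain u where u: "u \<in> C" "\<forall>x\<in>f ` {A \<in> \<A>. A \<subseteq> C}. le x u"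
    using directed_finite_bound[OF system_directed[OF \<C> C] system_nonempty[OF \<C> C]] by blast
  have "le y u" if y: "y \<in> C" for y
  proof -
    obtain A where A: "A \<in> \<A>" "y \<in> A"
      using system_cover[OF \<A>(1)] system_subset[OF \<C> C] y by blast
    then have "A \<subseteq> C" using co system_disjoint[OF \<C> C] y unfolding coarser_def by blast
    then show ?thesis using u f A le_trans by blast
  qed
  then show ?thesis using u by blast
qed

end

section \<open>Coarsest systems\<close>

text \<open>
  With \<open>\<M>\<close> a system of least cardinality, sending a member of \<open>\<M>\<close> to the block of \<open>join \<M> \<B>\<close> that
  contains it is onto; by minimality it is injective, so every block consists of a single member.
\<close>

lemma coarsest_exists:
  assumes fin: "finite \<A>" "is_system \<A>"
    and cover: "\<And>\<A>. is_system \<A> \<Longrightarrow> \<Union>\<A> = T \<and> pairwise disjnt \<A> \<and> (\<forall>A\<in>\<A>. A \<noteq> {})"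
    and join: "\<And>\<A> \<B>. finite \<A> \<Longrightarrow> is_system \<A> \<Longrightarrow> is_system \<B> \<Longrightarrow> is_system (join \<A> \<B>)"
  shows "\<exists>\<A>. coarsest is_system \<A>"
proof -
  obtain \<M> where M: "finite \<M>" "is_system \<M>"
    and min: "\<And>\<B>. finite \<B> \<Longrightarrow> is_system \<B> \<Longrightarrow> card \<M> \<le> card \<B>"
    using exists_least_iff[of "\<lambda>n. \<exists>\<A>. finite \<A> \<and> is_system \<A> \<and> card \<A> = n"] fin
    by (metis not_le_imp_less)
  have "coarser \<M> \<B>" if B: "is_system \<B>" for \<B>
  proof -
    let ?J = "join \<M> \<B>"
    note cM = cover[OF M(2)] and cB = cover[OF B] and J = join[OF M B]
    note cJ = cover[OF J]
    have "\<forall>A\<in>\<M> \<union> \<B>. A \<noteq> {}" using cM cB by blast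
    then have co: "coarser ?J \<M>" "coarser ?J \<B>" using coarser_join[of \<M> T \<B>] cM cB by blast+
    then obtain f where f: "\<And>A. A \<in> \<M> \<Longrightarrow> f A \<in> ?J \<and> A \<subseteq> f A" unfolding coarser_def by metis
    have eq: "f A = C" if "C \<in> ?J" "A \<in> \<M>" "x \<in> A" "x \<in> C" for A C x
      using join_eqI[of "f A" \<M> \<B> C x] f that by blast
    have surj: "f ` \<M> = ?J"
    proof
      show "f ` \<M> \<subseteq> ?J" using f by blast
      show "?J \<subseteq> f ` \<M>"
      proof
        fix C assume C: "C \<in> ?J"
        then obtain x where x: "x \<in> C" using cJ by blast
        then obtain A where "A \<in> \<M>" "x \<in> A" using cM cJ C by blast
        then show "C \<in> f ` \<M>" using eq C x by blast
      qed
    qed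
    then have "finite ?J" using M(1) by (metis finite_imageI)
    then have "card \<M> \<le> card (f ` \<M>)" using min[OF _ J] surj by simp
    then have inj: "inj_on f \<M>"
      using M(1) card_image_le[of \<M> f] eq_card_imp_inj_on[of \<M> f] by linarith
    have "C \<in> \<M>" if C: "C \<in> ?J" for C
    proof -
      have "C \<in> f ` \<M>" using C unfolding surj .
      then obtain A where A: "A \<in> \<M>" "f A = C" by auto
      have "C \<subseteq> A"
      proof
        fix x assume x: "x \<in> C"
        then obtain A' where A': "A' \<in> \<M>" "x \<in> A'" using cM cJ C by blast
        then have "f A' = f A" using eq[OF C A' x] A by simp
        then show "x \<in> A" using inj A A' by (auto dest: inj_onD)
      qed
      then show ?thesis using f A by (metis subset_antisym)
    qed
    then show ?thesis using co(2) unfolding coarser_def by blast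
  qed
  then show ?thesis using M unfolding coarsest_def by blast
qed

section \<open>Future and past systems as abstract systems\<close>

context dspace_with_equivalences
begin

text \<open>
  For the given direction, all laws are instances of 2-out-of-3 and of the homotopies above.
\<close>

sublocale future: stable_paths "topspace (underlying X)" "dpaths X" "\<lambda>\<alpha>. \<alpha> 0" "\<lambda>\<alpha>. \<alpha> 1"
  concat_path const_path "extension_in F X" "\<lambda>\<alpha> z. L \<alpha> z" "\<lambda>x \<beta>. R x \<beta>" "\<lambda>x y. F_contractible F (P x y)"
proof
  fix \<alpha> z assume a: "\<alpha> \<in> dpaths X" and L: "L \<alpha> z"
  show "F_contractible F (P (\<alpha> 1) z) \<longleftrightarrow> F_contractible F (P (\<alpha> 0) z)"
    using F_contractible_iff[OF continuous_left[OF a] L] by simp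
next
  fix x \<beta> assume b: "\<beta> \<in> dpaths X" and R: "R x \<beta>" and c: "F_contractible F (P x (\<beta> 0))"
  show "F_contractible F (P x (\<beta> 1))"
    using F_contractible_iff[OF continuous_right[OF b] R] c by simp
next
  fix \<alpha> \<beta> assume "\<alpha> \<in> dpaths X" "\<beta> \<in> dpaths X" "R (\<alpha> 0) \<beta>" "R (\<alpha> 1) \<beta>" "L \<alpha> (\<beta> 1)"
  then show "L \<alpha> (\<beta> 0)" using extension_iff_L extension_iff_L' by blast
next
  fix \<alpha> \<gamma> z assume *: "\<alpha> \<in> dpaths X" "\<gamma> \<in> dpaths X" "\<alpha> 1 = \<gamma> 0"
  show "L \<alpha> z \<Longrightarrow> L \<gamma> z \<Longrightarrow> L (concat_path \<alpha> \<gamma>) z" using L_concat_compose[OF *] .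
  show "L (concat_path \<alpha> \<gamma>) z \<Longrightarrow> L \<gamma> z \<Longrightarrow> L \<alpha> z" using L_concat_left[OF *] .
  show "L (concat_path \<alpha> \<gamma>) z \<Longrightarrow> L \<alpha> z \<Longrightarrow> L \<gamma> z" using L_concat_right[OF *] .
next
  fix \<alpha> \<gamma> assume "\<alpha> \<in> dpaths X" "\<gamma> \<in> dpaths X" "\<gamma> 0 = \<alpha> 0" "L \<alpha> (\<gamma> 1)"
  then show "\<exists>\<delta>\<in>dpaths X. \<delta> 0 = \<alpha> 1 \<and> \<delta> 1 = \<gamma> 1" by (rule L_nonempty)
next
  fix \<gamma> \<delta> z assume "\<gamma> \<in> dpaths X" "\<delta> \<in> dpaths X" "\<gamma> 0 = \<delta> 0" "\<gamma> 1 = \<delta> 1"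
    "F_contractible F (P (\<gamma> 0) (\<gamma> 1))" "L \<gamma> z"
  then show "L \<delta> z" by (rule contractible_L)
qed (simp_all add: dpath_in_topspace const_dpath concat_dpath extension_const_right
    extension_const_left extension_iff_R)

text \<open>
  The same laws with the two ends of paths, and left and right extension, exchanged.
\<close>

sublocale past: stable_paths "topspace (underlying X)" "dpaths X" "\<lambda>\<alpha>. \<alpha> 1" "\<lambda>\<alpha>. \<alpha> 0"
  "\<lambda>\<alpha> \<beta>. concat_path \<beta> \<alpha>" const_path "\<lambda>\<alpha> \<beta>. extension_in F X \<beta> \<alpha>"
  "\<lambda>\<alpha> z. R z \<alpha>" "\<lambda>x \<beta>. L \<beta> x" "\<lambda>x y. F_contractible F (P y x)"
proof
  fix \<alpha> z assume a: "\<alpha> \<in> dpaths X" and R: "R z \<alpha>"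
  show "F_contractible F (P z (\<alpha> 0)) \<longleftrightarrow> F_contractible F (P z (\<alpha> 1))"
    using F_contractible_iff[OF continuous_right[OF a] R] by simp
next
  fix x \<beta> assume b: "\<beta> \<in> dpaths X" and L: "L \<beta> x" and c: "F_contractible F (P (\<beta> 1) x)"
  show "F_contractible F (P (\<beta> 0) x)"
    using F_contractible_iff[OF continuous_left[OF b] L] c by simp
next
  fix \<alpha> \<beta> assume "\<alpha> \<in> dpaths X" "\<beta> \<in> dpaths X" "L \<beta> (\<alpha> 1)" "L \<beta> (\<alpha> 0)" "R (\<beta> 0) \<alpha>"
  then show "R (\<beta> 1) \<alpha>" using extension_iff_R extension_iff_R' by blast
next
  fix \<alpha> \<beta> assume "\<alpha> \<in> dpaths X" "\<beta> \<in> dpaths X" "R (\<beta> 1) \<alpha>"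
  then show "extension_in F X \<beta> \<alpha> \<longleftrightarrow> L \<beta> (\<alpha> 1)" using extension_iff_L' by blast
next
  fix \<gamma> \<delta> z assume "\<gamma> \<in> dpaths X" "\<delta> \<in> dpaths X" "\<gamma> 1 = \<delta> 1" "\<gamma> 0 = \<delta> 0"
    "F_contractible F (P (\<gamma> 0) (\<gamma> 1))" "R z \<gamma>"
  then show "R z \<delta>" using contractible_R by blast
next
  fix \<alpha> \<gamma> z assume *: "\<alpha> \<in> dpaths X" "\<gamma> \<in> dpaths X" "\<alpha> 0 = \<gamma> 1"
  show "R z \<alpha> \<Longrightarrow> R z \<gamma> \<Longrightarrow> R z (concat_path \<gamma> \<alpha>)"
    using R_concat_compose[OF *(2,1) *(3)[symmetric]] by blast
  show "R z (concat_path \<gamma> \<alpha>) \<Longrightarrow> R z \<gamma> \<Longrightarrow> R z \<alpha>"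
    using R_concat_right[OF *(2,1) *(3)[symmetric]] .
  show "R z (concat_path \<gamma> \<alpha>) \<Longrightarrow> R z \<alpha> \<Longrightarrow> R z \<gamma>"
    using R_concat_left[OF *(2,1) *(3)[symmetric]] .
next
  fix \<alpha> \<gamma> assume *: "\<alpha> \<in> dpaths X" "\<gamma> \<in> dpaths X" "\<gamma> 1 = \<alpha> 1" "R (\<gamma> 0) \<alpha>"
  show "\<exists>\<delta>\<in>dpaths X. \<delta> 1 = \<alpha> 0 \<and> \<delta> 0 = \<gamma> 0" using R_nonempty[OF *] by blast
qed (simp_all add: dpath_in_topspace const_dpath concat_dpath extension_const_right
    extension_const_left)

lemma le_iff: "future.le x y \<longleftrightarrow> d_le X x y" "past.le x y \<longleftrightarrow> d_le X y x"
  unfolding future.le_def past.le_def d_le_def ex_in_conv[symmetric] dpaths_from_to_iff by blast+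

text \<open>
  Initial and final segments of a d-path are d-paths.
\<close>

lemma dpath_le:
  assumes \<alpha>: "\<alpha> \<in> dpaths X" and u: "u \<in> {0..1}"
  shows "d_le X (\<alpha> 0) (\<alpha> u)" "d_le X (\<alpha> u) (\<alpha> 1)"
proof -
  have "restrict (\<alpha> \<circ> (\<lambda>v. u * v)) {0..1} \<in> dpaths X"
    using u by (intro reparam_dpath \<alpha> continuous_intros)
      (auto intro!: mono_onI mult_left_mono mult_le_one)
  then have "restrict (\<alpha> \<circ> (\<lambda>v. u * v)) {0..1} \<in> dpaths_from_to X (\<alpha> 0) (\<alpha> u)"
    unfolding dpaths_from_to_iff by simp
  then show "d_le X (\<alpha> 0) (\<alpha> u)" unfolding d_le_def by blast
  have "restrict (\<alpha> \<circ> (\<lambda>v. u + (1 - u) * v)) {0..1} \<in> dpaths X"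
  proof (intro reparam_dpath \<alpha> continuous_intros)
    show "mono_on {0..1} (\<lambda>v. u + (1 - u) * v)"
      using u by (intro mono_onI add_left_mono mult_left_mono) auto
    have "u + (1 - u) * v \<le> 1" if "v \<le> 1" for v
      using mult_left_mono[OF that, of "1 - u"] u by simp
    moreover have "0 \<le> u + (1 - u) * v" if "0 \<le> v" for v
      using u that by (intro add_nonneg_nonneg mult_nonneg_nonneg) auto
    ultimately show "(\<lambda>v. u + (1 - u) * v) ` {0..1} \<subseteq> {0..1}" by (simp add: image_subset_iff)
  qed
  then have "restrict (\<alpha> \<circ> (\<lambda>v. u + (1 - u) * v)) {0..1} \<in> dpaths_from_to X (\<alpha> u) (\<alpha> 1)"
    unfolding dpaths_from_to_iff by simp
  then show "d_le X (\<alpha> u) (\<alpha> 1)" unfolding d_le_def by blast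
qed

lemma d_le_trans: "d_le X x y \<Longrightarrow> d_le X y z \<Longrightarrow> d_le X x z"
  using future.le_trans unfolding le_iff .

text \<open>
  A point between two others lies on a concatenation of d-paths through it, and conversely every
  point of a d-path lies between its ends.
\<close>

lemma d_convex_iff:
  assumes A: "A \<subseteq> topspace (underlying X)"
  shows "d_convex X A \<longleftrightarrow> (\<forall>x\<in>A. \<forall>z\<in>A. \<forall>y. d_le X x y \<longrightarrow> d_le X y z \<longrightarrow> y \<in> A)"
proof
  assume c: "d_convex X A"
  show "\<forall>x\<in>A. \<forall>z\<in>A. \<forall>y. d_le X x y \<longrightarrow> d_le X y z \<longrightarrow> y \<in> A"
  proof (intro ballI allI impI)
    fix x z y assume xz: "x \<in> A" "z \<in> A" and "d_le X x y" "d_le X y z"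
    then obtain \<alpha> \<beta> where \<alpha>: "\<alpha> \<in> dpaths X" "\<alpha> 0 = x" "\<alpha> 1 = y" and \<beta>: "\<beta> \<in> dpaths X" "\<beta> 0 = y" "\<beta> 1 = z"
      unfolding d_le_def ex_in_conv[symmetric] dpaths_from_to_iff by blast
    have "concat_path \<alpha> \<beta> \<in> dpaths X" using concat_dpath \<alpha> \<beta> by simp
    then have "concat_path \<alpha> \<beta> \<in> dpaths_between X (topspace (underlying X)) A A"
      using \<alpha> \<beta> xz dpath_in_topspace by (auto simp: dpaths_between_def dpaths_in_def)
    then have "concat_path \<alpha> \<beta> \<in> dpaths_between X A A A" using c by (simp add: d_convex_def)
    then have "concat_path \<alpha> \<beta> ` {0..1} \<subseteq> A" by (simp add: dpaths_between_def dpaths_in_def)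
    then have "concat_path \<alpha> \<beta> (1/2) \<in> A" by auto
    then show "y \<in> A" using \<alpha> by (simp add: concat_path_def)
  qed
next
  assume c: "\<forall>x\<in>A. \<forall>z\<in>A. \<forall>y. d_le X x y \<longrightarrow> d_le X y z \<longrightarrow> y \<in> A"
  have "\<alpha> ` {0..1} \<subseteq> A" if "\<alpha> \<in> dpaths X" "\<alpha> 0 \<in> A" "\<alpha> 1 \<in> A" for \<alpha>
    using c that dpath_le[OF that(1)] by blast
  then show "d_convex X A"
    unfolding d_convex_def dpaths_between_def dpaths_in_def using A dpath_in_topspace by blast
qed

lemma dpaths_in_d_convex:
  assumes "d_convex X A" "A \<subseteq> topspace (underlying X)"
  shows "dpaths_in X A = {\<alpha> \<in> dpaths X. \<alpha> 0 \<in> A \<and> \<alpha> 1 \<in> A}"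
    and "dpaths_in X (up_part X A z) = {\<alpha> \<in> dpaths X. \<alpha> 0 \<in> A \<and> \<alpha> 1 \<in> A \<and> d_le X z (\<alpha> 0)}"
    and "dpaths_in X (down_part X A z) = {\<alpha> \<in> dpaths X. \<alpha> 0 \<in> A \<and> \<alpha> 1 \<in> A \<and> d_le X (\<alpha> 1) z}"
proof -
  have im: "\<alpha> u \<in> A" if "\<alpha> \<in> dpaths X" "\<alpha> 0 \<in> A" "\<alpha> 1 \<in> A" "u \<in> {0..1}" for \<alpha> u
    using assms(1) that dpath_le[OF that(1,4)] unfolding d_convex_iff[OF assms(2)] by blast
  have 01: "0 \<in> {0..1::real}" "1 \<in> {0..1::real}" by auto
  show "dpaths_in X A = {\<alpha> \<in> dpaths X. \<alpha> 0 \<in> A \<and> \<alpha> 1 \<in> A}"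
    unfolding dpaths_in_def using im 01 by blast
  show "dpaths_in X (up_part X A z) = {\<alpha> \<in> dpaths X. \<alpha> 0 \<in> A \<and> \<alpha> 1 \<in> A \<and> d_le X z (\<alpha> 0)}"
    unfolding dpaths_in_def up_part_def using im 01 dpath_le(1) d_le_trans by blast
  show "dpaths_in X (down_part X A z) = {\<alpha> \<in> dpaths X. \<alpha> 0 \<in> A \<and> \<alpha> 1 \<in> A \<and> d_le X (\<alpha> 1) z}"
    unfolding dpaths_in_def down_part_def using im 01 dpath_le(2) d_le_trans by blast
qed

lemma
  assumes "d_convex X A" "A \<subseteq> topspace (underlying X)"
  shows future_connected_iff: "future_connected X A \<longleftrightarrow> future.directed A"
    and past_connected_iff: "past_connected X A \<longleftrightarrow> past.directed A"
    and St_future_eq: "St_future F X \<alpha> A = future.St \<alpha> A"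
    and St_past_eq: "St_past F X A \<alpha> = past.St \<alpha> A"
proof -
  have ne: "dpaths_between X A {x} {y} \<noteq> {} \<longleftrightarrow> d_le X x y" if "x \<in> A" "y \<in> A" for x y
    unfolding d_le_def ex_in_conv[symmetric] dpaths_from_to_iff
    unfolding dpaths_between_def dpaths_in_d_convex[OF assms] using that by auto
  show "future_connected X A \<longleftrightarrow> future.directed A"
    unfolding future_connected_def future.directed_def le_iff using ne by auto
  show "past_connected X A \<longleftrightarrow> past.directed A"
    unfolding past_connected_def past.directed_def le_iff using ne by auto
  show "St_future F X \<alpha> A = future.St \<alpha> A"
    unfolding St_future_def future.St_def le_iff dpaths_in_d_convex[OF assms] by blast
  show "St_past F X A \<alpha> = past.St \<alpha> A"
    unfolding St_past_def past.St_def le_iff dpaths_in_d_convex[OF assms] by blast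
qed

lemma
  assumes A: "A \<subseteq> topspace (underlying X)"
  shows future_convex_iff: "future.order_convex A \<longleftrightarrow> d_convex X A"
    and past_convex_iff: "past.order_convex A \<longleftrightarrow> d_convex X A"
  unfolding future.order_convex_def past.order_convex_def le_iff d_convex_iff[OF A] by blast+

lemma stable_future_system_iff: "stable_future_system F X \<A> \<longleftrightarrow> future.system \<A>"
\<comment> \<open>The concrete and the abstract notions of stability agree for d-convex sets, and both kinds of
  system consist of such sets.\<close>
proof (cases "\<Union>\<A> = topspace (underlying X) \<and> (\<forall>A\<in>\<A>. d_convex X A \<and> future.directed A)")
  case True
  then have sub: "A \<subseteq> topspace (underlying X)" if "A \<in> \<A>" for A using that by blast
  have conv: "d_convex X A" "future.directed A" if "A \<in> \<A>" for A using that True by blast+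
  have st: "future_stable F X A B \<longleftrightarrow> future.stable A B" if "A \<in> \<A>" "B \<in> \<A>" for A B
    unfolding future_stable_def future.stable_def
      future_connected_iff[OF conv(1)[OF that(1)] sub[OF that(1)]]
      future_connected_iff[OF conv(1)[OF that(2)] sub[OF that(2)]]
      dpaths_in_d_convex(1)[OF conv(1)[OF that(1)] sub[OF that(1)]]
      St_future_eq[OF conv(1)[OF that(2)] sub[OF that(2)]]
    using conv(2)[OF that(1)] conv(2)[OF that(2)] by blast
  have tr: "future_trivial F X A \<longleftrightarrow> future.stable A A \<and>
      (\<exists>a\<in>A. \<exists>z\<in>future.St (const_path a) A. F_contractible F (P a z))" if "A \<in> \<A>" for A
    unfolding future_trivial_def st[OF that that] SP_future_def St_future_eq[OF conv(1)[OF that] sub[OF that]]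
    by blast
  show ?thesis
    unfolding stable_future_system_def future.system_def disjoint_cover_def
    using True st tr future_convex_iff[OF sub] future_connected_iff[OF conv(1) sub] by auto
next
  case False
  have "\<Union>\<A> = topspace (underlying X) \<and> (\<forall>A\<in>\<A>. d_convex X A \<and> future.directed A)"
    if "stable_future_system F X \<A>"
  proof -
    have u: "\<Union>\<A> = topspace (underlying X)" and c: "\<forall>A\<in>\<A>. d_convex X A \<and> future_connected X A"
      using that unfolding stable_future_system_def disjoint_cover_def by blast+
    then show ?thesis using future_connected_iff by blast
  qed
  moreover have "\<Union>\<A> = topspace (underlying X) \<and> (\<forall>A\<in>\<A>. d_convex X A \<and> future.directed A)"
    if sys: "future.system \<A>"
  proof (intro conjI ballI future.system_cover[OF sys])
    fix A assume A: "A \<in> \<A>"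
    show "d_convex X A"
      using future.system_convex[OF sys A] future_convex_iff[OF future.system_subset[OF sys A]] by simp
    show "future.directed A" using future.system_directed[OF sys A] .
  qed
  ultimately show ?thesis using False by blast
qed

lemma stable_past_system_iff: "stable_past_system F X \<A> \<longleftrightarrow> past.system \<A>"
\<comment> \<open>As for future systems; the order of the two sets in a stable pair is reversed as well.\<close>
proof (cases "\<Union>\<A> = topspace (underlying X) \<and> (\<forall>A\<in>\<A>. d_convex X A \<and> past.directed A)")
  case True
  then have sub: "A \<subseteq> topspace (underlying X)" if "A \<in> \<A>" for A using that by blast
  have conv: "d_convex X A" "past.directed A" if "A \<in> \<A>" for A using that True by blast+
  have st: "past_stable F X A B \<longleftrightarrow> past.stable B A" if "A \<in> \<A>" "B \<in> \<A>" for A B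
    unfolding past_stable_def past.stable_def
      past_connected_iff[OF conv(1)[OF that(1)] sub[OF that(1)]]
      past_connected_iff[OF conv(1)[OF that(2)] sub[OF that(2)]]
      dpaths_in_d_convex(1)[OF conv(1)[OF that(2)] sub[OF that(2)]]
      St_past_eq[OF conv(1)[OF that(1)] sub[OF that(1)]]
    using conv(2)[OF that(1)] conv(2)[OF that(2)] by blast
  have tr: "past_trivial F X A \<longleftrightarrow> past.stable A A \<and>
      (\<exists>a\<in>A. \<exists>z\<in>past.St (const_path a) A. F_contractible F (P z a))" if "A \<in> \<A>" for A
    unfolding past_trivial_def st[OF that that] SP_past_def St_past_eq[OF conv(1)[OF that] sub[OF that]]
    by blast
  show ?thesis
    unfolding stable_past_system_def past.system_def disjoint_cover_def
    using True st tr past_convex_iff[OF sub] past_connected_iff[OF conv(1) sub] by auto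
next
  case False
  have "\<Union>\<A> = topspace (underlying X) \<and> (\<forall>A\<in>\<A>. d_convex X A \<and> past.directed A)"
    if "stable_past_system F X \<A>"
  proof -
    have u: "\<Union>\<A> = topspace (underlying X)" and c: "\<forall>A\<in>\<A>. d_convex X A \<and> past_connected X A"
      using that unfolding stable_past_system_def disjoint_cover_def by blast+
    then show ?thesis using past_connected_iff by blast
  qed
  moreover have "\<Union>\<A> = topspace (underlying X) \<and> (\<forall>A\<in>\<A>. d_convex X A \<and> past.directed A)"
    if sys: "past.system \<A>"
  proof (intro conjI ballI past.system_cover[OF sys])
    fix A assume A: "A \<in> \<A>"
    show "d_convex X A"
      using past.system_convex[OF sys A] past_convex_iff[OF past.system_subset[OF sys A]] by simp
    show "past.directed A" using past.system_directed[OF sys A] .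
  qed
  ultimately show ?thesis using False by blast
qed

section \<open>Existence and closedness of coarsest systems\<close>

text \<open>
  Take a stabilizing pair for the past end \<open>Z\<close> of \<open>C\<close> and the future end \<open>Z'\<close> of \<open>C'\<close>, both of which
  are members of \<open>\<A>\<close>. Below a point of \<open>Z\<close> the class \<open>C\<close> agrees with \<open>Z\<close>, and above a point of \<open>Z'\<close>
  the class \<open>C'\<close> agrees with \<open>Z'\<close>.
\<close>

lemma totally_stable_join:
  assumes A: "stable_total_system F X \<A>" and B: "stable_total_system F X \<B>" and fin: "finite \<A>"
    and C: "C \<in> join \<A> \<B>" and C': "C' \<in> join \<A> \<B>"
  shows "\<exists>a\<in>C. \<exists>b\<in>C'. b \<in> St_future F X (const_path a) C' \<and> a \<in> St_past F X C (const_path b)"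
proof -
  have fut: "future.system \<A>" "future.system \<B>" and pas: "past.system \<A>" "past.system \<B>"
    using A B by (simp_all add: stable_total_system_def stable_future_system_iff stable_past_system_iff)
  note fj = future.system_join[OF fut fin]
  obtain Z where Z: "past.terminal \<A> \<B> Z" "Z \<subseteq> C" using past.terminal_exists[OF pas fin C] by blast
  obtain Z' where Z': "future.terminal \<A> \<B> Z'" "Z' \<subseteq> C'"
    using future.terminal_exists[OF fut fin C'] by blast
  note mem = past.terminal_mem[OF pas fin Z(1)] future.terminal_mem[OF fut fin Z'(1)]
  then obtain a b where ab: "a \<in> Z" "b \<in> Z'" "b \<in> St_future F X (const_path a) Z'"
      "a \<in> St_past F X Z (const_path b)"
    using A unfolding stable_total_system_def totally_stable_def by blast
  have sub: "C \<subseteq> topspace (underlying X)" "C' \<subseteq> topspace (underlying X)" "Z \<subseteq> topspace (underlying X)"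
      "Z' \<subseteq> topspace (underlying X)"
    using future.system_subset[OF fj] C C' future.system_subset[OF fut(1)] mem by blast+
  have conv: "d_convex X C" "d_convex X C'" "d_convex X Z" "d_convex X Z'"
    using future_convex_iff sub future.system_convex[OF fj] future.system_convex[OF fut(1)] C C' mem
    by blast+
  have "b \<in> future.St (const_path a) C'"
    using ab(3) future.St_terminal[OF fut fin Z' C'] unfolding St_future_eq[OF conv(4) sub(4)] by blast
  moreover have "a \<in> past.St (const_path b) C"
    using ab(4) past.St_terminal[OF pas fin Z C] unfolding St_past_eq[OF conv(3) sub(3)] by blast
  ultimately show ?thesis
    unfolding St_future_eq[OF conv(2) sub(2)] St_past_eq[OF conv(1) sub(1)] using ab(1,2) Z(2) Z'(2) by blast
qed

lemma stable_total_system_join: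
  assumes A: "stable_total_system F X \<A>" and B: "stable_total_system F X \<B>" and fin: "finite \<A>"
  shows "stable_total_system F X (join \<A> \<B>)"
proof -
  have 1: "stable_future_system F X (join \<A> \<B>)"
    using A B future.system_join[OF _ _ fin] by (simp add: stable_total_system_def stable_future_system_iff)
  have 2: "stable_past_system F X (join \<A> \<B>)"
    using A B past.system_join[OF _ _ fin] by (simp add: stable_total_system_def stable_past_system_iff)
  have "totally_stable F X C C'" if "C \<in> join \<A> \<B>" "C' \<in> join \<A> \<B>" for C C'
    using 1 2 that totally_stable_join[OF assms that]
    unfolding totally_stable_def stable_future_system_def stable_past_system_def by blast
  then show ?thesis using 1 2 unfolding stable_total_system_def by blast
qed

lemma coarsest_future_exists:
  assumes "finite \<A>" "stable_future_system F X \<A>"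
  shows "\<exists>\<A>. coarsest (stable_future_system F X) \<A>"
proof (rule coarsest_exists[where is_system = "stable_future_system F X", OF assms])
  fix \<A> assume "stable_future_system F X \<A>"
  then show "\<Union>\<A> = topspace (underlying X) \<and> pairwise disjnt \<A> \<and> (\<forall>A\<in>\<A>. A \<noteq> {})"
    using future.system_nonempty unfolding stable_future_system_iff by (auto simp: future.system_def)
qed (simp add: stable_future_system_iff future.system_join)

lemma coarsest_past_exists:
  assumes "finite \<A>" "stable_past_system F X \<A>"
  shows "\<exists>\<A>. coarsest (stable_past_system F X) \<A>"
proof (rule coarsest_exists[where is_system = "stable_past_system F X", OF assms])
  fix \<A> assume "stable_past_system F X \<A>"
  then show "\<Union>\<A> = topspace (underlying X) \<and> pairwise disjnt \<A> \<and> (\<forall>A\<in>\<A>. A \<noteq> {})"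
    using past.system_nonempty unfolding stable_past_system_iff by (auto simp: past.system_def)
qed (simp add: stable_past_system_iff past.system_join)

lemma coarsest_total_exists:
  assumes "finite \<A>" "stable_total_system F X \<A>"
  shows "\<exists>\<A>. coarsest (stable_total_system F X) \<A>"
proof (rule coarsest_exists[where is_system = "stable_total_system F X", OF assms])
  fix \<A> assume "stable_total_system F X \<A>"
  then have "future.system \<A>" by (simp add: stable_total_system_def stable_future_system_iff)
  then show "\<Union>\<A> = topspace (underlying X) \<and> pairwise disjnt \<A> \<and> (\<forall>A\<in>\<A>. A \<noteq> {})"
    using future.system_nonempty by (auto simp: future.system_def)
qed (simp add: stable_total_system_join)

lemma coarsest_future_closed:
  assumes "finite \<A>" "stable_future_system F X \<A>" "future_closed X \<A>"
    and "coarsest (stable_future_system F X) \<C>"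
  shows "future_closed X \<C>"
  using future.closed_coarser[of \<C> \<A>] assms
  unfolding future_closed_def coarsest_def stable_future_system_iff le_iff by blast

lemma coarsest_past_closed:
  assumes "finite \<A>" "stable_past_system F X \<A>" "past_closed X \<A>"
    and "coarsest (stable_past_system F X) \<C>"
  shows "past_closed X \<C>"
  using past.closed_coarser[of \<C> \<A>] assms
  unfolding past_closed_def coarsest_def stable_past_system_iff le_iff by blast

end

theorem theorem4p10:
  fixes X :: "'a dspace" and F :: "'u morphism_family"
  assumes "d_space X" and "no_loops X"
    and "equivalence_system F"
    and "(UNIV :: (real \<Rightarrow> 'a) set) \<lesssim> (UNIV :: 'u set)"
  shows "((\<exists>\<A>. finite \<A> \<and> stable_future_system F X \<A>)
            \<longrightarrow> (\<exists>\<A>. coarsest (stable_future_system F X) \<A>))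
       \<and> ((\<exists>\<A>. finite \<A> \<and> stable_past_system F X \<A>)
            \<longrightarrow> (\<exists>\<A>. coarsest (stable_past_system F X) \<A>))
       \<and> ((\<exists>\<A>. finite \<A> \<and> stable_total_system F X \<A>)
            \<longrightarrow> (\<exists>\<A>. coarsest (stable_total_system F X) \<A>))
       \<and> ((\<exists>\<A>. finite \<A> \<and> stable_future_system F X \<A> \<and> future_closed X \<A>)
            \<longrightarrow> (\<forall>\<A>. coarsest (stable_future_system F X) \<A> \<longrightarrow> future_closed X \<A>))
       \<and> ((\<exists>\<A>. finite \<A> \<and> stable_past_system F X \<A> \<and> past_closed X \<A>)
            \<longrightarrow> (\<forall>\<A>. coarsest (stable_past_system F X) \<A> \<longrightarrow> past_closed X \<A>))"
proof -
  interpret dspace_with_equivalences F X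
    using assms(1,3) by unfold_locales
  show ?thesis
    by (intro conjI impI allI; elim exE conjE)
      (rule coarsest_future_exists coarsest_past_exists coarsest_total_exists
        coarsest_future_closed coarsest_past_closed; assumption)+
qed

end
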